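(* Let $\mathcal{A}$ be an Arens regular Banach algebra, let $M$ be a finite-dimensional subspace of $\mathcal{A}''$, let $N$ be a finite-dimensional subspace of $\mathcal{A}'$, and let $\epsilon>0$. Let $M_0=M+M\,\Box\,M$ and $N_0=N+M\cdot N$. Then there exists a linear map $T:M_0\rightarrow\mathcal{A}$ which is a $(1+\epsilon)$-isomorphism onto its range, such that: (1) $\langle\Phi,\mu\rangle=\langle\mu,T(\Phi)\rangle$ for all $\Phi\in M_0$ and $\mu\in N_0$; (2) $T(\kappa_{\mathcal{A}}(a))=a$ for all $a\in\mathcal{A}$ with $\kappa_{\mathcal{A}}(a)\in M_0$; (3) $|\langle\mu,T(\Phi\,\Box\,\Psi)-T(\Phi)T(\Psi)\rangle|\leq\epsilon\|\mu\|\|\Phi\|\|\Psi\|$ for all $\mu\in N$ and $\Phi,\Psi\in M$.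
   Context: $\mathcal{A}'$ is the dual of $\mathcal{A}$, $\langle\mu,a\rangle=\mu(a)$, and $\kappa_{\mathcal{A}}:\mathcal{A}\rightarrow\mathcal{A}''$ is the canonical embedding. Arens products: for $a,b\in\mathcal{A}$, $\mu\in\mathcal{A}'$, $\Phi,\Psi\in\mathcal{A}''$, put $\langle a\cdot\mu,b\rangle=\langle\mu,ba\rangle$, $\langle\mu\cdot a,b\rangle=\langle\mu,ab\rangle$, $\langle\Phi\cdot\mu,a\rangle=\langle\Phi,\mu\cdot a\rangle$, $\langle\mu\cdot\Phi,a\rangle=\langle\Phi,a\cdot\mu\rangle$, $\langle\Phi\,\Box\,\Psi,\mu\rangle=\langle\Phi,\Psi\cdot\mu\rangle$, $\langle\Phi\,\Diamond\,\Psi,\mu\rangle=\langle\Psi,\mu\cdot\Phi\rangle$. $\mathcal{A}$ is Arens regular if $\Box=\Diamond$ on $\mathcal{A}''$. $M\,\Box\,M$ denotes the linear span of $\{\Phi\,\Box\,\Psi:\Phi,\Psi\in M\}$, and $M\cdot N$ the linear span of $\{\Phi\cdot\mu:\Phi\in M,\mu\in N\}$. A bounded linear map $T:F\rightarrow G$ between Banach spaces is a $(1+\epsilon)$-isomorphism onto its range if $(1-\epsilon)\|x\|\leq\|T(x)\|\leq(1+\epsilon)\|x\|$ for all $x\in F$. *)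

theory Defs
  imports "HOL-Analysis.Analysis" "HOL-Library.Function_Algebras"
begin

text \<open>
  The scalar field is either the reals or the complex numbers. Both cases are treated at once by a
  type class of normed fields that are isometrically isomorphic, over the reals, to one of the two.
\<close>

class real_or_complex = real_normed_field +
  assumes ex_real_or_complex_iso:
    "\<exists>h :: 'a \<Rightarrow> complex.
       (\<forall>x y. h (x + y) = h x + h y) \<and> (\<forall>x y. h (x * y) = h x * h y) \<and>
       (\<forall>r x. h (r *\<^sub>R x) = r *\<^sub>R h x) \<and> (\<forall>x. norm (h x) = norm x) \<and>
       (range h = \<real> \<or> range h = UNIV)"

instance real :: real_or_complex
proof
  show "\<exists>h :: real \<Rightarrow> complex.
       (\<forall>x y. h (x + y) = h x + h y) \<and> (\<forall>x y. h (x * y) = h x * h y) \<and>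
       (\<forall>r x. h (r *\<^sub>R x) = r *\<^sub>R h x) \<and> (\<forall>x. norm (h x) = norm x) \<and>
       (range h = \<real> \<or> range h = UNIV)"
    by (rule exI[of _ complex_of_real]) (auto simp: scaleR_conv_of_real Reals_def)
qed

instance complex :: real_or_complex
proof
  show "\<exists>h :: complex \<Rightarrow> complex.
       (\<forall>x y. h (x + y) = h x + h y) \<and> (\<forall>x y. h (x * y) = h x * h y) \<and>
       (\<forall>r x. h (r *\<^sub>R x) = r *\<^sub>R h x) \<and> (\<forall>x. norm (h x) = norm x) \<and>
       (range h = \<real> \<or> range h = UNIV)"
    by (rule exI[of _ id]) auto
qed

text \<open>
  A (not necessarily unital) Banach algebra over the field \<open>'k\<close>. The type classes supply the
  underlying complete real normed algebra with submultiplicative norm; \<open>smul\<close> is the action of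
  the scalars, which restricts to the given action of the reals.
\<close>

locale banach_algebra_over = vector_space smul
  for smul :: "'k::real_or_complex \<Rightarrow> 'a::{real_normed_algebra, banach} \<Rightarrow> 'a" +
  assumes smul_of_real: "smul (of_real r) x = r *\<^sub>R x"
    and norm_smul: "norm (smul c x) = norm c * norm x"
    and smul_mult_left: "smul c x * y = smul c (x * y)"
    and smul_mult_right: "x * smul c y = smul c (x * y)"

lemma banach_algebra_over_real:
  "banach_algebra_over ((*\<^sub>R) :: real \<Rightarrow> 'a::{real_normed_algebra, banach} \<Rightarrow> 'a)"
  by unfold_locales (simp_all add: scaleR_add_right scaleR_add_left)

lemma banach_algebra_over_complex:
  "banach_algebra_over ((*) :: complex \<Rightarrow> complex \<Rightarrow> complex)"
  by unfold_locales (simp_all add: algebra_simps norm_mult scaleR_conv_of_real)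

definition fun_scale :: "'k::field \<Rightarrow> ('b \<Rightarrow> 'k) \<Rightarrow> 'b \<Rightarrow> 'k" where
  "fun_scale c f = (\<lambda>x. c * f x)"

lemma vector_space_fun_scale: "vector_space (fun_scale :: 'k::field \<Rightarrow> ('b \<Rightarrow> 'k) \<Rightarrow> 'b \<Rightarrow> 'k)"
  by unfold_locales (simp_all add: fun_scale_def fun_eq_iff algebra_simps)

text \<open>The norm of the dual space is \<^const>\<open>onorm\<close>.\<close>

definition dual :: "('k::real_or_complex \<Rightarrow> 'a::{real_normed_algebra, banach} \<Rightarrow> 'a) \<Rightarrow> ('a \<Rightarrow> 'k) set" where
  "dual smul = {\<mu>. bounded_linear \<mu> \<and> (\<forall>c a. \<mu> (smul c a) = c * \<mu> a)}"

text \<open>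
  A functional on the dual is encoded as a function on the whole type \<open>'a \<Rightarrow> 'k\<close> that vanishes
  outside the dual, so that equality of elements of the bidual is equality of functions.
\<close>

definition bidual ::
  "('k::real_or_complex \<Rightarrow> 'a::{real_normed_algebra, banach} \<Rightarrow> 'a) \<Rightarrow> (('a \<Rightarrow> 'k) \<Rightarrow> 'k) set" where
  "bidual smul = {\<Phi>.
     (\<forall>\<mu>\<in>dual smul. \<forall>\<nu>\<in>dual smul. \<Phi> (\<mu> + \<nu>) = \<Phi> \<mu> + \<Phi> \<nu>) \<and>
     (\<forall>c. \<forall>\<mu>\<in>dual smul. \<Phi> (fun_scale c \<mu>) = c * \<Phi> \<mu>) \<and>
     (\<exists>B. \<forall>\<mu>\<in>dual smul. norm (\<Phi> \<mu>) \<le> B * onorm \<mu>) \<and>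
     (\<forall>\<mu>. \<mu> \<notin> dual smul \<longrightarrow> \<Phi> \<mu> = 0)}"

definition bidual_norm ::
  "('k::real_or_complex \<Rightarrow> 'a::{real_normed_algebra, banach} \<Rightarrow> 'a) \<Rightarrow> (('a \<Rightarrow> 'k) \<Rightarrow> 'k) \<Rightarrow> real" where
  "bidual_norm smul \<Phi> = (SUP \<mu>\<in>{\<mu>\<in>dual smul. onorm \<mu> \<le> 1}. norm (\<Phi> \<mu>))"

definition canonical_embedding ::
  "('k::real_or_complex \<Rightarrow> 'a::{real_normed_algebra, banach} \<Rightarrow> 'a) \<Rightarrow> 'a \<Rightarrow> ('a \<Rightarrow> 'k) \<Rightarrow> 'k" where
  "canonical_embedding smul a = (\<lambda>\<mu>. if \<mu> \<in> dual smul then \<mu> a else 0)"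

text \<open>
  The four module actions: in \<open>alg_dual\<close> and \<open>bidual_dual\<close> the functional in the dual stands on
  the right of the product, in \<open>dual_alg\<close> and \<open>dual_bidual\<close> on the left.
\<close>

definition alg_dual :: "'a::times \<Rightarrow> ('a \<Rightarrow> 'k) \<Rightarrow> 'a \<Rightarrow> 'k" where
  "alg_dual a \<mu> = (\<lambda>b. \<mu> (b * a))"

definition dual_alg :: "('a::times \<Rightarrow> 'k) \<Rightarrow> 'a \<Rightarrow> 'a \<Rightarrow> 'k" where
  "dual_alg \<mu> a = (\<lambda>b. \<mu> (a * b))"

definition bidual_dual :: "(('a::times \<Rightarrow> 'k) \<Rightarrow> 'k) \<Rightarrow> ('a \<Rightarrow> 'k) \<Rightarrow> 'a \<Rightarrow> 'k" where
  "bidual_dual \<Phi> \<mu> = (\<lambda>a. \<Phi> (dual_alg \<mu> a))"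

definition dual_bidual :: "('a::times \<Rightarrow> 'k) \<Rightarrow> (('a \<Rightarrow> 'k) \<Rightarrow> 'k) \<Rightarrow> 'a \<Rightarrow> 'k" where
  "dual_bidual \<mu> \<Phi> = (\<lambda>a. \<Phi> (alg_dual a \<mu>))"

definition arens_box ::
  "('k::real_or_complex \<Rightarrow> 'a::{real_normed_algebra, banach} \<Rightarrow> 'a) \<Rightarrow>
    (('a \<Rightarrow> 'k) \<Rightarrow> 'k) \<Rightarrow> (('a \<Rightarrow> 'k) \<Rightarrow> 'k) \<Rightarrow> ('a \<Rightarrow> 'k) \<Rightarrow> 'k" where
  "arens_box smul \<Phi> \<Psi> = (\<lambda>\<mu>. if \<mu> \<in> dual smul then \<Phi> (bidual_dual \<Psi> \<mu>) else 0)"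

definition arens_diamond ::
  "('k::real_or_complex \<Rightarrow> 'a::{real_normed_algebra, banach} \<Rightarrow> 'a) \<Rightarrow>
    (('a \<Rightarrow> 'k) \<Rightarrow> 'k) \<Rightarrow> (('a \<Rightarrow> 'k) \<Rightarrow> 'k) \<Rightarrow> ('a \<Rightarrow> 'k) \<Rightarrow> 'k" where
  "arens_diamond smul \<Phi> \<Psi> = (\<lambda>\<mu>. if \<mu> \<in> dual smul then \<Psi> (dual_bidual \<mu> \<Phi>) else 0)"

definition arens_regular ::
  "('k::real_or_complex \<Rightarrow> 'a::{real_normed_algebra, banach} \<Rightarrow> 'a) \<Rightarrow> bool" where
  "arens_regular smul \<longleftrightarrow>
     (\<forall>\<Phi>\<in>bidual smul. \<forall>\<Psi>\<in>bidual smul. arens_box smul \<Phi> \<Psi> = arens_diamond smul \<Phi> \<Psi>)"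

definition fin_dim_subspace :: "('k::field \<Rightarrow> 'v::ab_group_add \<Rightarrow> 'v) \<Rightarrow> 'v set \<Rightarrow> bool" where
  "fin_dim_subspace s V \<longleftrightarrow> module.subspace s V \<and> (\<exists>B. finite B \<and> V = module.span s B)"

definition subspace_sum :: "'v::plus set \<Rightarrow> 'v set \<Rightarrow> 'v set" where
  "subspace_sum U V = {u + v |u v. u \<in> U \<and> v \<in> V}"

definition box_span ::
  "('k::real_or_complex \<Rightarrow> 'a::{real_normed_algebra, banach} \<Rightarrow> 'a) \<Rightarrow>
    (('a \<Rightarrow> 'k) \<Rightarrow> 'k) set \<Rightarrow> (('a \<Rightarrow> 'k) \<Rightarrow> 'k) set" where
  "box_span smul M = module.span fun_scale {arens_box smul \<Phi> \<Psi> |\<Phi> \<Psi>. \<Phi> \<in> M \<and> \<Psi> \<in> M}"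

definition action_span ::
  "(('a::times \<Rightarrow> 'k::field) \<Rightarrow> 'k) set \<Rightarrow> ('a \<Rightarrow> 'k) set \<Rightarrow> ('a \<Rightarrow> 'k) set" where
  "action_span M N = module.span fun_scale {bidual_dual \<Phi> \<mu> |\<Phi> \<mu>. \<Phi> \<in> M \<and> \<mu> \<in> N}"

definition linear_map_on ::
  "('k \<Rightarrow> 'v::plus \<Rightarrow> 'v) \<Rightarrow> ('k \<Rightarrow> 'w::plus \<Rightarrow> 'w) \<Rightarrow> 'v set \<Rightarrow> ('v \<Rightarrow> 'w) \<Rightarrow> bool" where
  "linear_map_on s t V T \<longleftrightarrow>
     (\<forall>x\<in>V. \<forall>y\<in>V. T (x + y) = T x + T y) \<and> (\<forall>c. \<forall>x\<in>V. T (s c x) = t c (T x))"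

text \<open>The upper estimate makes boundedness of \<open>T\<close> on \<open>V\<close> automatic.\<close>

definition eps_isomorphism_on ::
  "real \<Rightarrow> 'v set \<Rightarrow> ('v \<Rightarrow> real) \<Rightarrow> ('w \<Rightarrow> real) \<Rightarrow> ('v \<Rightarrow> 'w) \<Rightarrow> bool" where
  "eps_isomorphism_on \<epsilon> V nV nW T \<longleftrightarrow>
     (\<forall>x\<in>V. (1 - \<epsilon>) * nV x \<le> nW (T x) \<and> nW (T x) \<le> (1 + \<epsilon>) * nV x)"

end

theory Submission
  imports Defs
begin

text \<open>
  Local reflexivity is proved by one Hahn--Banach separation. An operator on the span of a basis
  \<open>B\<close> of \<open>M\<^sub>0\<close> is a tuple of vectors, one for each \<open>b \<in> B\<close>. The conditions (1) and (2) are finitely many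
  linear equations, which are solvable; the norm bounds on a finite net and the approximations
  \<open>\<mu> \<cdot> T \<Phi> \<approx> \<mu> \<cdot> \<Phi>\<close> ask that an affine subspace of a finite product of copies of the algebra and of
  its dual meet a ball. If it does not, a functional on this product separates them; Arens
  regularity, in the form \<open>\<Phi> (\<Lambda> \<cdot> \<mu>) = \<Lambda> (\<mu> \<cdot> \<Phi>)\<close>, lets one compute its value and gives a contradiction.
  Finally, if \<open>\<mu> \<cdot> \<Phi>\<close> is one of the functionals on which (1) is exact, then
  \<open>\<mu> (T (\<Phi> \<box> \<Psi>) - T \<Phi> * T \<Psi>) = (\<mu> \<cdot> \<Phi> - \<mu> \<cdot> T \<Phi>) (T \<Psi>)\<close>, which is small.
\<close>

section \<open>Scalars and the Hahn--Banach theorem\<close>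

text \<open>Condition (3) is quadratic in the unknown operator, while separation can impose only
  convex conditions. It is linearised by splitting the product: exact interpolation at
  \<open>\<mu> \<cdot> \<Phi>\<close> disposes of \<open>T \<Psi>\<close>, since these functionals
  span a finite-dimensional space known before \<open>T\<close> is; what remains, that
  \<open>\<mu> \<cdot> T \<Phi>\<close> approximates \<open>\<mu> \<cdot> \<Phi>\<close>, is affine
  in \<open>T\<close>. The approximation must hold in the norm of the dual, because it is tested at
  the vector \<open>T \<Psi>\<close>, which depends on \<open>T\<close> itself. Approximating
  \<open>\<Phi>\<close> weak* from the algebra makes these functionals converge only weak*;
  regularity improves this to weak convergence in the dual, and convexity turns weak into norm
  approximation. One separation performs all these passages together with the norm bounds.

  There is no circularity in the constants: the error constant and the test vectors depend only on
  bases and on \<open>\<epsilon>\<close>, so the tolerance is fixed before the operator is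
  found.\<close>

definition scalar_iso :: "('k::real_or_complex \<Rightarrow> complex) \<Rightarrow> bool" where
  "scalar_iso h \<longleftrightarrow> (\<forall>x y. h (x + y) = h x + h y) \<and> (\<forall>x y. h (x * y) = h x * h y) \<and>
     (\<forall>r x. h (r *\<^sub>R x) = r *\<^sub>R h x) \<and> (\<forall>x. norm (h x) = norm x) \<and>
     (range h = \<real> \<or> range h = UNIV)"

lemma ex_scalar_iso: "\<exists>h :: 'k::real_or_complex \<Rightarrow> complex. scalar_iso h"
  unfolding scalar_iso_def by (rule ex_real_or_complex_iso)

lemma scalar_isoD:
  fixes h :: "'k::real_or_complex \<Rightarrow> complex"
  assumes "scalar_iso h"
  shows "h (x + y) = h x + h y" "h (x * y) = h x * h y" "h (x - y) = h x - h y"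
    "norm (h x) = norm x" "h (of_real r) = of_real r" "inj h" "range h = \<real> \<or> range h = UNIV"
proof -
  have h: "\<And>x y. h (x + y) = h x + h y" "\<And>x y. h (x * y) = h x * h y"
    "\<And>r x. h (r *\<^sub>R x) = r *\<^sub>R h x" "\<And>x. norm (h x) = norm x" "range h = \<real> \<or> range h = UNIV"
    using assms unfolding scalar_iso_def by blast+
  have "h 1 \<noteq> 0"
    using h(4)[of 1] by auto
  then have h1: "h 1 = 1"
    using h(2)[of 1 1] by simp
  have diff: "h (x - y) = h x - h y" for x y
    using h(1)[of "x - y" y] by simp
  show "inj h"
  proof (rule injI)
    fix x y assume "h x = h y"
    then have "norm (x - y) = 0" using h(4)[of "x - y"] diff by simp
    then show "x = y" by simp
  qed
  show "h (of_real r) = of_real r"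
    using h(3)[of r 1] h1 by (simp add: of_real_def)
  show "h (x + y) = h x + h y" "h (x * y) = h x * h y" "h (x - y) = h x - h y"
    "norm (h x) = norm x" "range h = \<real> \<or> range h = UNIV"
    by (fact h diff)+
qed

text \<open>Compactness is borrowed from the complex disc: the isometry \<open>h\<close> has closed
  range in either case, and balls centred at points of the range cover the part of the disc in that
  range, so a finite subcover has its centres in the field itself.\<close>

lemma finite_scalar_net:
  fixes C e :: real
  assumes "e > 0"
  obtains G :: "'k::real_or_complex set"
    where "finite G" "\<And>x. norm x \<le> C \<Longrightarrow> \<exists>g\<in>G. norm (x - g) < e"
proof -
  obtain h :: "'k \<Rightarrow> complex" where "scalar_iso h"
    using ex_scalar_iso by blast
  note h = scalar_isoD(4,3,7)[OF this]
  have "closed (range h)"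
    using h(3) closed_complex_Reals by auto
  then have "compact (cball 0 C \<inter> range h)"
    by (simp add: compact_Int_closed)
  moreover have "cball 0 C \<inter> range h \<subseteq> (\<Union>g\<in>UNIV. ball (h g) e)"
    using assms by auto
  ultimately obtain G where G: "finite G" "cball 0 C \<inter> range h \<subseteq> (\<Union>g\<in>G. ball (h g) e)"
    using compactE_image[of "cball 0 C \<inter> range h" UNIV "\<lambda>g. ball (h g) e"] by (metis open_ball)
  show thesis
  proof
    show "finite G" by fact
    fix x :: 'k assume "norm x \<le> C"
    then have "h x \<in> cball 0 C \<inter> range h" by (simp add: h)
    then obtain g where "g \<in> G" "h x \<in> ball (h g) e" using G by blast
    then have "norm (x - g) < e"
      by (metis dist_commute dist_norm h(1,2) mem_ball)
    then show "\<exists>g\<in>G. norm (x - g) < e" using \<open>g \<in> G\<close> by blast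
  qed
qed

text \<open>The functional \<open>\<phi>\<close> is the scalar-linear one whose real part is \<open>g\<close>.\<close>

lemma ex_linear_lift:
  fixes s :: "'k::real_or_complex \<Rightarrow> 'v::ab_group_add \<Rightarrow> 'v"
  assumes "vector_space s" and W: "module.subspace s W"
    and g_add: "\<And>x y. x \<in> W \<Longrightarrow> y \<in> W \<Longrightarrow> g (x + y) = g x + g y"
    and g_scale: "\<And>r x. x \<in> W \<Longrightarrow> g (s (of_real r) x) = r * g x"
    and g_le: "\<And>x. x \<in> W \<Longrightarrow> g x \<le> p x"
    and p_scale: "\<And>k x. x \<in> W \<Longrightarrow> p (s k x) \<le> norm k * p x"
  obtains \<phi> :: "'v \<Rightarrow> 'k" where
    "\<And>x y. x \<in> W \<Longrightarrow> y \<in> W \<Longrightarrow> \<phi> (x + y) = \<phi> x + \<phi> y"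
    "\<And>k x. x \<in> W \<Longrightarrow> \<phi> (s k x) = k * \<phi> x"
    "\<And>x. x \<in> W \<Longrightarrow> norm (\<phi> x) \<le> p x"
    "\<And>x. x \<in> W \<Longrightarrow> \<bar>g x\<bar> \<le> norm (\<phi> x)"
    "\<And>x. x \<in> W \<Longrightarrow> (\<And>k. g (s k x) = 0) \<Longrightarrow> \<phi> x = 0"
proof -
  interpret vector_space s by fact
  note W_scale = subspace_scale[OF W]
  obtain h :: "'k \<Rightarrow> complex" where "scalar_iso h"
    using ex_scalar_iso by blast
  note h = scalar_isoD[OF this]
  have "\<exists>\<phi> :: 'v \<Rightarrow> 'k. (\<forall>x\<in>W. \<forall>y\<in>W. \<phi> (x + y) = \<phi> x + \<phi> y) \<and> (\<forall>k. \<forall>x\<in>W. \<phi> (s k x) = k * \<phi> x) \<and>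
     (\<forall>x\<in>W. Re (h (\<phi> x)) = g x) \<and> (\<forall>x\<in>W. (\<forall>k. g (s k x) = 0) \<longrightarrow> \<phi> x = 0)"
    using h(7)
  proof
    assume R: "range h = \<real>"
    have all_real: "\<exists>r. k = of_real r" for k :: 'k
    proof -
      have "h k \<in> \<real>" using R by blast
      then obtain r where "h k = of_real r" by (auto simp: Reals_def)
      then show ?thesis using h(5)[of r] h(6) by (metis injD)
    qed
    show ?thesis
    proof (intro exI[of _ "\<lambda>x. of_real (g x)"] conjI ballI allI impI)
      fix k x assume "x \<in> W"
      then show "of_real (g (s k x)) = k * of_real (g x)"
        using all_real[of k] g_scale by auto
    next
      fix x assume "\<forall>k. g (s k x) = 0"
      then show "of_real (g x) = (0::'k)" using scale_one[of x] by (metis of_real_0)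
    qed (simp_all add: g_add h)
  next
    assume R: "range h = UNIV"
    then obtain i where i: "h i = \<i>" by (metis surjD)
    have ii: "i * i = -1"
      by (rule injD[OF h(6)]) (metis h(2,5) i i_squared of_real_1 of_real_minus)
    have split: "\<exists>a b. k = of_real a + i * of_real b" for k :: 'k
    proof -
      have "h k = h (of_real (Re (h k)) + i * of_real (Im (h k)))"
        by (simp add: h i complex_eq)
      then show ?thesis using h(6) by (metis injD)
    qed
    \<comment> \<open>The classical formula \<open>g x - i * g (i x)\<close>; linearity over the
      field reduces to real scalars and multiplication by \<open>i\<close>.\<close>
    define \<phi> where "\<phi> x = of_real (g x) - i * of_real (g (s i x))" for x
    have add: "\<phi> (x + y) = \<phi> x + \<phi> y" if "x \<in> W" "y \<in> W" for x y
      using that by (simp add: \<phi>_def g_add W_scale scale_right_distrib algebra_simps)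
    have comm: "s i (s (of_real r) x) = s (of_real r) (s i x)" for r x
      by (simp add: mult.commute)
    have real: "\<phi> (s (of_real r) x) = of_real r * \<phi> x" if "x \<in> W" for r x
      unfolding \<phi>_def comm g_scale[OF that] g_scale[OF W_scale[OF that]] by (simp add: algebra_simps)
    have imag: "\<phi> (s i x) = i * \<phi> x" if "x \<in> W" for x
    proof -
      have "g (s i (s i x)) = - g x"
        using g_scale[OF that, of "-1"] by (simp add: ii)
      then show ?thesis
        by (simp add: \<phi>_def algebra_simps) (simp add: mult.assoc[symmetric] ii)
    qed
    have scale: "\<phi> (s k x) = k * \<phi> x" if x: "x \<in> W" for k x
    proof -
      obtain a b where k: "k = of_real a + i * of_real b" using split by blast
      have "s k x = s (of_real a) x + s i (s (of_real b) x)"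
        by (simp add: k scale_left_distrib)
      also have "\<phi> \<dots> = of_real a * \<phi> x + i * (of_real b * \<phi> x)"
        by (simp only: add imag real W_scale x)
      finally show ?thesis
        by (simp add: k algebra_simps)
    qed
    show ?thesis
    proof (intro exI[of _ \<phi>] conjI ballI allI impI)
      fix x assume "x \<in> W"
      show "Re (h (\<phi> x)) = g x" by (simp add: \<phi>_def h i)
    next
      fix x assume "\<forall>k. g (s k x) = 0"
      then show "\<phi> x = 0" using scale_one[of x] unfolding \<phi>_def by (metis diff_0_right mult_zero_right of_real_0)
    qed (simp_all add: add scale)
  qed
  then obtain \<phi> :: "'v \<Rightarrow> 'k" where add: "\<And>x y. x \<in> W \<Longrightarrow> y \<in> W \<Longrightarrow> \<phi> (x + y) = \<phi> x + \<phi> y"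
    and scale: "\<And>k x. x \<in> W \<Longrightarrow> \<phi> (s k x) = k * \<phi> x"
    and re: "\<And>x. x \<in> W \<Longrightarrow> Re (h (\<phi> x)) = g x"
    and null: "\<And>x. x \<in> W \<Longrightarrow> (\<And>k. g (s k x) = 0) \<Longrightarrow> \<phi> x = 0"
    by blast
  show thesis
  proof
    fix x assume x: "x \<in> W"
    show "\<bar>g x\<bar> \<le> norm (\<phi> x)"
      using abs_Re_le_cmod[of "h (\<phi> x)"] by (simp add: re x h)
    \<comment> \<open>Both \<open>g x\<close> and \<open>- g x = g (- x)\<close> lie below
      \<open>p x\<close>, as \<open>p (- x) \<le> p x\<close>.\<close>
    have p0: "0 \<le> p x"
      using p_scale[OF x, of 0] p_scale[OF x, of "-1"] g_le[of "s 0 x"] g_scale[OF x, of 0]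
        g_le[of x] g_le[of "s (-1) x"] g_scale[OF x, of "-1"] x W_scale[of x "-1"] W_scale[of x 0]
      by simp
    show "norm (\<phi> x) \<le> p x"
    proof (cases "\<phi> x = 0")
      case False
      \<comment> \<open>Rotating \<open>x\<close> by the unimodular \<open>c\<close> makes the value
        of \<open>\<phi>\<close> real and nonnegative, so that it equals the value of
        \<open>g\<close>, which \<open>p\<close> bounds.\<close>
      define c where "c = of_real (norm (\<phi> x)) / \<phi> x"
      have c: "norm c = 1" using False by (simp add: c_def norm_divide)
      have "\<phi> (s c x) = of_real (norm (\<phi> x))"
        using False x by (simp add: scale c_def)
      then have "norm (\<phi> x) = g (s c x)"
        using re[of "s c x"] W_scale[OF x, of c] h(5) by simp
      also have "\<dots> \<le> p (s c x)" using g_le W_scale[OF x] by simp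
      also have "\<dots> \<le> p x" using p_scale[OF x, of c] c by simp
      finally show ?thesis .
    qed (use p0 in simp)
  qed (use add scale null in blast)+
qed

text \<open>
  Zorn's lemma is applied to graphs lying below \<open>p\<close>; such a graph is automatically single-valued,
  because \<open>p 0 = 0\<close>.
\<close>

definition real_graph :: "('k::real_or_complex \<Rightarrow> 'v::ab_group_add \<Rightarrow> 'v) \<Rightarrow> ('v \<times> real) set \<Rightarrow> bool" where
  "real_graph s G \<longleftrightarrow> (0, 0) \<in> G \<and>
     (\<forall>x a y b. (x, a) \<in> G \<longrightarrow> (y, b) \<in> G \<longrightarrow> (x + y, a + b) \<in> G) \<and>
     (\<forall>r x a. (x, a) \<in> G \<longrightarrow> (s (of_real r) x, r * a) \<in> G)"

lemma real_graphD:
  assumes "real_graph s G"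
  shows "(0, 0) \<in> G" "\<And>x a y b. (x, a) \<in> G \<Longrightarrow> (y, b) \<in> G \<Longrightarrow> (x + y, a + b) \<in> G"
    "\<And>r x a. (x, a) \<in> G \<Longrightarrow> (s (of_real r) x, r * a) \<in> G"
  using assms unfolding real_graph_def by blast+

lemma real_graph_Union:
  assumes "C \<noteq> {}" "\<And>G. G \<in> C \<Longrightarrow> real_graph s G" "\<And>G H. G \<in> C \<Longrightarrow> H \<in> C \<Longrightarrow> G \<subseteq> H \<or> H \<subseteq> G"
  shows "real_graph s (\<Union>C)"
  unfolding real_graph_def
proof (intro conjI allI impI)
  show "(0, 0) \<in> \<Union>C" using assms(1,2) real_graphD(1) by fast
next
  fix x a y b assume "(x, a) \<in> \<Union>C" "(y, b) \<in> \<Union>C"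
  then obtain G H where "G \<in> C" "H \<in> C" "(x, a) \<in> G" "(y, b) \<in> H" by blast
  then show "(x + y, a + b) \<in> \<Union>C"
    using assms(2,3)[of G] assms(2)[of H] assms(3)[of G H] real_graphD(2) by (metis Union_iff subsetD)
next
  fix r x a assume "(x, a) \<in> \<Union>C"
  then show "(s (of_real r) x, r * a) \<in> \<Union>C" using assms(2) real_graphD(3) by blast
qed

text \<open>The one-dimensional step of Hahn--Banach: subadditivity puts every lower bound for the
  value at \<open>z\<close> below every upper bound. No case distinction on whether \<open>z\<close>
  already lies in the domain is made; if it does, the bounds force \<open>\<xi>\<close> to be the
  old value.\<close>

lemma dominated_graph_extend:
  fixes s :: "'k::real_or_complex \<Rightarrow> 'v::ab_group_add \<Rightarrow> 'v"
  assumes "vector_space s" and W: "module.subspace s W"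
    and p_add: "\<And>x y. x \<in> W \<Longrightarrow> y \<in> W \<Longrightarrow> p (x + y) \<le> p x + p y"
    and p_scale: "\<And>k x. x \<in> W \<Longrightarrow> p (s k x) \<le> norm k * p x"
    and G: "real_graph s G" and dom: "\<And>x a. (x, a) \<in> G \<Longrightarrow> x \<in> W \<and> a \<le> p x"
    and z: "z \<in> W"
  obtains H \<xi> where "real_graph s H" "G \<subseteq> H" "(z, \<xi>) \<in> H" "\<And>x a. (x, a) \<in> H \<Longrightarrow> x \<in> W \<and> a \<le> p x"
proof -
  interpret vector_space s by fact
  note W_scale = subspace_scale[OF W] and W_add = subspace_add[OF W] and W_diff = subspace_diff[OF W]
  define S where "S = {a - p (x - z) |x a. (x, a) \<in> G}"
  have key: "a - p (x - z) \<le> p (y + z) - b" if "(x, a) \<in> G" "(y, b) \<in> G" for x a y b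
  proof -
    have "a + b \<le> p (x + y)" using real_graphD(2)[OF G that] dom by blast
    also have "\<dots> = p ((x - z) + (y + z))" by simp
    also have "\<dots> \<le> p (x - z) + p (y + z)"
      using that dom z W_diff W_add by (intro p_add) blast+
    finally show ?thesis by simp
  qed
  define \<xi> where "\<xi> = Sup S"
  have S0: "S \<noteq> {}" and bdd: "bdd_above S"
    using real_graphD(1)[OF G] key[OF _ real_graphD(1)[OF G]] by (auto simp: S_def bdd_above_def)
  have up: "\<xi> \<le> p (y + z) - b" if "(y, b) \<in> G" for y b
    unfolding \<xi>_def using S0 key[OF _ that] by (intro cSup_least) (auto simp: S_def)
  have lo: "a - p (x - z) \<le> \<xi>" if "(x, a) \<in> G" for x a
    unfolding \<xi>_def using bdd that by (intro cSup_upper) (auto simp: S_def)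
  define H where "H = {(x + s (of_real t) z, a + t * \<xi>) |x a t. (x, a) \<in> G}"
  have HI: "(y, b) \<in> H" if "(x, a) \<in> G" "y = x + s (of_real t) z" "b = a + t * \<xi>" for x a t y b
    using that unfolding H_def by blast
  have HE: "\<exists>x a t. (x, a) \<in> G \<and> y = x + s (of_real t) z \<and> b = a + t * \<xi>" if "(y, b) \<in> H" for y b
    using that unfolding H_def by blast
  show thesis
  proof
    show "real_graph s H"
      unfolding real_graph_def
    proof (intro conjI allI impI)
      show "(0, 0) \<in> H"
        using HI[OF real_graphD(1)[OF G], of _ 0] by simp
    next
      fix x a y b assume "(x, a) \<in> H" "(y, b) \<in> H"
      then obtain x' a' t y' b' u where *: "(x', a') \<in> G" "(y', b') \<in> G"
        "x = x' + s (of_real t) z" "a = a' + t * \<xi>" "y = y' + s (of_real u) z" "b = b' + u * \<xi>"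
        using HE by metis
      then show "(x + y, a + b) \<in> H"
        by (intro HI[OF real_graphD(2)[OF G *(1,2)], of _ "t + u"])
          (simp_all add: scale_left_distrib algebra_simps)
    next
      fix r x a assume "(x, a) \<in> H"
      then obtain x' a' t where *: "(x', a') \<in> G" "x = x' + s (of_real t) z" "a = a' + t * \<xi>"
        using HE by metis
      then show "(s (of_real r) x, r * a) \<in> H"
        by (intro HI[OF real_graphD(3)[OF G *(1), of r], of _ "r * t"])
          (simp_all add: scale_right_distrib algebra_simps)
    qed
    show "G \<subseteq> H"
    proof
      fix q assume "q \<in> G"
      then show "q \<in> H" using HI[of "fst q" "snd q" "fst q" 0 "snd q"] by simp
    qed
    show "(z, \<xi>) \<in> H"
      using HI[OF real_graphD(1)[OF G], of z 1 \<xi>] by simp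
    fix y b assume "(y, b) \<in> H"
    then obtain x a t where x: "(x, a) \<in> G" and y: "y = x + s (of_real t) z" and b: "b = a + t * \<xi>"
      using HE by metis
    have xW: "x \<in> W" using dom x by blast
    have yW: "y \<in> W" using xW z W_add W_scale unfolding y by blast
    have "b \<le> p y"
    proof (cases "t = 0")
      case True
      then show ?thesis using dom[OF x] y b by simp
    next
      case False
      \<comment> \<open>Dividing by \<open>\<bar>t\<bar>\<close> reduces to the coefficients
        \<open>1\<close> and \<open>-1\<close> of \<open>z\<close>, which are governed by the upper
        bound \<open>up\<close> and the lower bound \<open>lo\<close>.\<close>
      define u where "u = \<bar>t\<bar>"
      have u: "u > 0" using False by (simp add: u_def)
      have G': "(s (of_real (1/u)) x, 1/u * a) \<in> G" using real_graphD(3)[OF G x] .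
      have *: "1/u * b \<le> p (s (of_real (1/u)) y)"
      proof (cases "t > 0")
        case True
        then have ut: "u = t" by (simp add: u_def)
        have "s (of_real (1/u)) y = s (of_real (1/u)) x + z"
          using u by (simp add: y ut scale_right_distrib flip: of_real_mult)
        then show ?thesis using up[OF G'] u by (simp add: b ut field_simps)
      next
        case f: False
        then have ut: "t = - u" by (simp add: u_def)
        have "s (of_real (1/u)) y = s (of_real (1/u)) x - z"
          using u by (simp add: y ut scale_right_diff_distrib)
        moreover have "1/u * b = 1/u * a - \<xi>" using u by (simp add: b ut field_simps)
        ultimately show ?thesis using lo[OF G'] by simp
      qed
      also have "\<dots> \<le> 1/u * p y"
        using p_scale[OF yW, of "of_real (1/u)"] u by (simp add: norm_divide)
      finally show ?thesis using u by (simp add: field_simps)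
    qed
    then show "y \<in> W \<and> b \<le> p y" using yW by simp
  qed
qed

text \<open>A maximal dominated graph is total on \<open>W\<close>, since otherwise the
  one-dimensional step would enlarge it. Everything is relative to a subspace \<open>W\<close>
  because \<open>p\<close> will be built from \<open>onorm\<close>, which behaves like a norm on the
  dual but not on arbitrary functions.\<close>

lemma ex_dominated_functional:
  fixes s :: "'k::real_or_complex \<Rightarrow> 'v::ab_group_add \<Rightarrow> 'v"
  assumes vs: "vector_space s" and W: "module.subspace s W"
    and p_add: "\<And>x y. x \<in> W \<Longrightarrow> y \<in> W \<Longrightarrow> p (x + y) \<le> p x + p y"
    and p_scale: "\<And>k x. x \<in> W \<Longrightarrow> p (s k x) \<le> norm k * p x"
    and G: "real_graph s G" and dom: "\<And>x a. (x, a) \<in> G \<Longrightarrow> x \<in> W \<and> a \<le> p x"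
  obtains g where "\<And>x y. x \<in> W \<Longrightarrow> y \<in> W \<Longrightarrow> g (x + y) = g x + g y"
    "\<And>r x. x \<in> W \<Longrightarrow> g (s (of_real r) x) = r * g x" "\<And>x. x \<in> W \<Longrightarrow> g x \<le> p x"
    "\<And>x a. (x, a) \<in> G \<Longrightarrow> g x = a"
proof -
  interpret vector_space s by fact
  define \<G> where "\<G> = {H. real_graph s H \<and> G \<subseteq> H \<and> (\<forall>x a. (x, a) \<in> H \<longrightarrow> x \<in> W \<and> a \<le> p x)}"
  have "\<exists>H\<in>\<G>. \<forall>H'\<in>\<G>. H \<subseteq> H' \<longrightarrow> H' = H"
  proof (rule subset_Zorn_nonempty)
    show "\<G> \<noteq> {}" using G dom by (auto simp: \<G>_def)
    fix C assume C: "C \<noteq> {}" "subset.chain \<G> C"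
    then have "C \<subseteq> \<G>" "\<And>G H. G \<in> C \<Longrightarrow> H \<in> C \<Longrightarrow> G \<subseteq> H \<or> H \<subseteq> G"
      unfolding subset_chain_def by blast+
    then have "real_graph s (\<Union>C)"
      using C(1) by (intro real_graph_Union) (auto simp: \<G>_def)
    moreover have "G \<subseteq> \<Union>C" using C(1) \<open>C \<subseteq> \<G>\<close> unfolding \<G>_def by blast
    moreover have "\<forall>x a. (x, a) \<in> \<Union>C \<longrightarrow> x \<in> W \<and> a \<le> p x"
      using \<open>C \<subseteq> \<G>\<close> unfolding \<G>_def by blast
    ultimately show "\<Union>C \<in> \<G>" by (simp add: \<G>_def)
  qed
  then obtain H where H: "real_graph s H" "G \<subseteq> H" "\<And>x a. (x, a) \<in> H \<Longrightarrow> x \<in> W \<and> a \<le> p x"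
    and max: "\<And>H'. H' \<in> \<G> \<Longrightarrow> H \<subseteq> H' \<Longrightarrow> H' = H"
    by (auto simp: \<G>_def)
  have total: "\<exists>a. (z, a) \<in> H" if z: "z \<in> W" for z
  proof -
    obtain H' \<xi> where H': "real_graph s H'" "H \<subseteq> H'" "(z, \<xi>) \<in> H'" "\<And>x a. (x, a) \<in> H' \<Longrightarrow> x \<in> W \<and> a \<le> p x"
      using dominated_graph_extend[OF vs W p_add p_scale H(1,3) z] by blast
    then have "H' = H" using max[of H'] H(2) by (auto simp: \<G>_def)
    then show ?thesis using H'(3) by blast
  qed
  have zero: "a = 0" if "(0, a) \<in> H" for a
  proof -
    have "0 \<in> W" using subspace_0[OF W] .
    then have "p 0 \<le> 0" using p_scale[of 0 0] by simp
    then show ?thesis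
      using H(3)[OF that] H(3)[OF real_graphD(3)[OF H(1) that, of "-1"]] by simp
  qed
  have unique: "a = b" if "(x, a) \<in> H" "(x, b) \<in> H" for x a b
    using zero[of "a - b"] real_graphD(2)[OF H(1) that(1) real_graphD(3)[OF H(1) that(2), of "-1"]] by simp
  define g where "g x = (THE a. (x, a) \<in> H)" for x
  have g_eq: "g x = a" if "(x, a) \<in> H" for x a
    unfolding g_def using that unique by blast
  have g_in: "(x, g x) \<in> H" if "x \<in> W" for x
    using total[OF that] g_eq by blast
  show thesis
  proof
    fix x y assume "x \<in> W" "y \<in> W"
    then show "g (x + y) = g x + g y" using g_in real_graphD(2)[OF H(1)] g_eq by blast
  next
    fix r x assume "x \<in> W"
    then show "g (s (of_real r) x) = r * g x" using g_in real_graphD(3)[OF H(1)] g_eq by blast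
  next
    fix x assume "x \<in> W" then show "g x \<le> p x" using g_in H(3) by blast
  next
    fix x a assume "(x, a) \<in> G" then show "g x = a" using g_eq H(2) by blast
  qed
qed

text \<open>The functional \<open>u + t d\<close> to \<open>t c\<close> is dominated by
  \<open>p\<close>: for \<open>t > 0\<close> this is the distance assumption after rescaling, and
  for \<open>t \<le> 0\<close> its value is nonpositive while \<open>p\<close> is nonnegative.
  Extending and then lifting to the full scalar field gives \<open>\<phi>\<close>.\<close>

lemma hahn_banach_dist:
  fixes s :: "'k::real_or_complex \<Rightarrow> 'v::ab_group_add \<Rightarrow> 'v"
  assumes vs: "vector_space s" and W: "module.subspace s W"
    and p_add: "\<And>x y. x \<in> W \<Longrightarrow> y \<in> W \<Longrightarrow> p (x + y) \<le> p x + p y"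
    and p_scale: "\<And>k x. x \<in> W \<Longrightarrow> p (s k x) \<le> norm k * p x"
    and U: "module.subspace s U" "U \<subseteq> W" and d: "d \<in> W" and c: "0 \<le> c"
    and dist: "\<And>u. u \<in> U \<Longrightarrow> c \<le> p (d + u)"
  obtains \<phi> :: "'v \<Rightarrow> 'k" where
    "\<And>x y. x \<in> W \<Longrightarrow> y \<in> W \<Longrightarrow> \<phi> (x + y) = \<phi> x + \<phi> y"
    "\<And>k x. x \<in> W \<Longrightarrow> \<phi> (s k x) = k * \<phi> x"
    "\<And>x. x \<in> W \<Longrightarrow> norm (\<phi> x) \<le> p x"
    "\<And>u. u \<in> U \<Longrightarrow> \<phi> u = 0" "c \<le> norm (\<phi> d)"
proof -
  interpret vector_space s by fact
  define G where "G = {(u + s (of_real t) d, t * c) |u t. u \<in> U}"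
  have GI: "(x, a) \<in> G" if "u \<in> U" "x = u + s (of_real t) d" "a = t * c" for u t x a
    using that unfolding G_def by blast
  have GE: "\<exists>u t. u \<in> U \<and> x = u + s (of_real t) d \<and> a = t * c" if "(x, a) \<in> G" for x a
    using that unfolding G_def by blast
  have G: "real_graph s G"
    unfolding real_graph_def
  proof (intro conjI allI impI)
    show "(0, 0) \<in> G"
      using GI[OF subspace_0[OF U(1)], of _ 0] by simp
  next
    fix x a y b assume "(x, a) \<in> G" "(y, b) \<in> G"
    then obtain u t v r where *: "u \<in> U" "v \<in> U" "x = u + s (of_real t) d" "a = t * c"
      "y = v + s (of_real r) d" "b = r * c" using GE by metis
    then show "(x + y, a + b) \<in> G"
      by (intro GI[OF subspace_add[OF U(1) *(1,2)], of _ "t + r"])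
        (simp_all add: scale_left_distrib algebra_simps)
  next
    fix r x a assume "(x, a) \<in> G"
    then obtain u t where *: "u \<in> U" "x = u + s (of_real t) d" "a = t * c" using GE by metis
    then show "(s (of_real r) x, r * a) \<in> G"
      by (intro GI[OF subspace_scale[OF U(1) *(1), of "of_real r"], of _ "r * t"])
        (simp_all add: scale_right_distrib algebra_simps)
  qed
  have dom: "x \<in> W \<and> a \<le> p x" if "(x, a) \<in> G" for x a
  proof -
    obtain u t where u: "u \<in> U" and x: "x = u + s (of_real t) d" and a: "a = t * c"
      using GE[OF \<open>(x, a) \<in> G\<close>] by blast
    have xW: "x \<in> W" using x u U(2) d subspace_add[OF W] subspace_scale[OF W] by blast
    have "a \<le> p x"
    proof (cases "t > 0")
      case True
      have "s (of_real (1/t)) x = d + s (of_real (1/t)) u"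
        using True by (simp add: x scale_right_distrib flip: of_real_mult)
      then have "c \<le> p (s (of_real (1/t)) x)"
        using dist[OF subspace_scale[OF U(1) u]] by simp
      also have "\<dots> \<le> 1/t * p x"
        using p_scale[OF xW, of "of_real (1/t)"] True by (simp add: norm_divide)
      finally show ?thesis using True by (simp add: a field_simps)
    next
      case False
      have "p (s 0 x) \<le> 0" using p_scale[OF xW, of 0] by simp
      moreover have "0 \<le> p 0"
        using p_add[OF subspace_0[OF W] subspace_0[OF W]] by simp
      moreover have "p 0 \<le> p x + p (s (-1) x)"
        using p_add[OF xW subspace_scale[OF W xW, of "-1"]] by simp
      ultimately have "0 \<le> p x" using p_scale[OF xW, of "-1"] by simp
      moreover have "a \<le> 0" using False c by (simp add: a mult_nonpos_nonneg)
      ultimately show ?thesis by simp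
    qed
    then show ?thesis using xW by simp
  qed
  obtain g where g: "\<And>x y. x \<in> W \<Longrightarrow> y \<in> W \<Longrightarrow> g (x + y) = g x + g y"
    "\<And>r x. x \<in> W \<Longrightarrow> g (s (of_real r) x) = r * g x" "\<And>x. x \<in> W \<Longrightarrow> g x \<le> p x"
    "\<And>x a. (x, a) \<in> G \<Longrightarrow> g x = a"
    using ex_dominated_functional[OF vs W p_add p_scale G dom] by blast
  obtain \<phi> :: "'v \<Rightarrow> 'k" where \<phi>: "\<And>x y. x \<in> W \<Longrightarrow> y \<in> W \<Longrightarrow> \<phi> (x + y) = \<phi> x + \<phi> y"
    "\<And>k x. x \<in> W \<Longrightarrow> \<phi> (s k x) = k * \<phi> x" "\<And>x. x \<in> W \<Longrightarrow> norm (\<phi> x) \<le> p x"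
    "\<And>x. x \<in> W \<Longrightarrow> \<bar>g x\<bar> \<le> norm (\<phi> x)"
    "\<And>x. x \<in> W \<Longrightarrow> (\<And>k. g (s k x) = 0) \<Longrightarrow> \<phi> x = 0"
    using ex_linear_lift[OF vs W g(1-3) p_scale] by blast
  \<comment> \<open>\<open>U\<close> is closed under all scalars, so \<open>g\<close> vanishes on
    every scalar multiple of \<open>u\<close>, and the lift \<open>\<phi>\<close> inherits this
    zero. At \<open>d\<close> only the estimate by the real part is required.\<close>
  have "g u = 0" if "u \<in> U" for u
    using g(4) GI[OF that, of u 0 0] by simp
  then have "\<phi> u = 0" if "u \<in> U" for u
    using \<phi>(5)[of u] that U(2) subspace_scale[OF U(1) that] by blast
  moreover have "g d = c"
    using g(4) GI[OF subspace_0[OF U(1)], of d 1 c] by simp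
  then have "c \<le> norm (\<phi> d)" using \<phi>(4)[OF d] by simp
  ultimately show thesis using that[of \<phi>] \<phi>(1-3) by blast
qed

section \<open>Linear maps on subspaces and separation in finite products\<close>

lemma sum_fun_apply: "(\<Sum>i\<in>I. f i) x = (\<Sum>i\<in>I. f i x :: 'k::comm_monoid_add)"
  by (induction I rule: infinite_finite_induct) auto

lemma linear_map_on_sum:
  assumes "vector_space s" "vector_space t" and S: "module.subspace s S" and T: "linear_map_on s t S T"
    and x: "\<And>i. i \<in> I \<Longrightarrow> x i \<in> S"
  shows "T (\<Sum>i\<in>I. s (c i) (x i)) = (\<Sum>i\<in>I. t (c i) (T (x i)))"
proof -
  interpret s: vector_space s by fact
  interpret t: vector_space t by fact
  have T0: "T 0 = 0"
    using T s.subspace_0[OF S] s.scale_zero_left[of 0] t.scale_zero_left unfolding linear_map_on_def by metis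
  show ?thesis
    using x
  proof (induction I rule: infinite_finite_induct)
    case (insert j J)
    have "s (c j) (x j) \<in> S" "(\<Sum>i\<in>J. s (c i) (x i)) \<in> S"
      using insert.prems by (auto intro!: s.subspace_scale[OF S] s.subspace_sum[OF S])
    then show ?case
      using insert T unfolding linear_map_on_def by simp
  qed (simp_all add: T0)
qed

lemma linear_map_on_diff:
  assumes "vector_space s" "vector_space t" and S: "module.subspace s S" and T: "linear_map_on s t S T"
    and "x \<in> S" "y \<in> S"
  shows "T (x - y) = T x - T y"
proof -
  interpret s: vector_space s by fact
  interpret t: vector_space t by fact
  have "x - y \<in> S" using assms s.subspace_diff by blast
  then have "T (x - y + y) = T (x - y) + T y" using T assms unfolding linear_map_on_def by blast
  then show ?thesis by simp
qed

lemma vector_space_pointwise: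
  assumes "vector_space s"
  shows "vector_space (\<lambda>k f i. s k (f i))"
proof -
  interpret vector_space s by fact
  show ?thesis by unfold_locales (simp_all add: fun_eq_iff scale_right_distrib scale_left_distrib)
qed

text \<open>In the weighted maximum norm the product of the balls of radius \<open>r i\<close> is
  the unit ball, so "every point of \<open>d + U\<close> leaves some ball" says that
  \<open>d\<close> has distance at least \<open>1\<close> from \<open>U\<close>. A functional on a
  finite product is a sum of functionals on the factors. The last conclusion bounds the whole sum on
  the product of balls, which is stronger than the separate bounds: contributions of different
  indices add up.\<close>

lemma hahn_banach_tuples:
  fixes s :: "'k::real_or_complex \<Rightarrow> 'v::ab_group_add \<Rightarrow> 'v" and I :: "'i set"
  assumes vs: "vector_space s" and W: "module.subspace s W"
    and n_add: "\<And>x y. x \<in> W \<Longrightarrow> y \<in> W \<Longrightarrow> n (x + y) \<le> n x + n y"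
    and n_scale: "\<And>k x. x \<in> W \<Longrightarrow> n (s k x) \<le> norm k * n x"
    and I: "finite I" and r: "\<And>i. i \<in> I \<Longrightarrow> r i > 0"
    and U: "module.subspace (\<lambda>k f i. s k (f i)) U" and UW: "\<And>u i. u \<in> U \<Longrightarrow> i \<in> I \<Longrightarrow> u i \<in> W"
    and d: "\<And>i. i \<in> I \<Longrightarrow> d i \<in> W"
    and dist: "\<And>u. u \<in> U \<Longrightarrow> \<exists>i\<in>I. r i \<le> n (d i + u i)"
  obtains \<phi> :: "'i \<Rightarrow> 'v \<Rightarrow> 'k" where
    "\<And>i. i \<in> I \<Longrightarrow> linear_map_on s (*) W (\<phi> i)"
    "\<And>i x. i \<in> I \<Longrightarrow> x \<in> W \<Longrightarrow> norm (\<phi> i x) \<le> n x / r i"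
    "\<And>u. u \<in> U \<Longrightarrow> (\<Sum>i\<in>I. \<phi> i (u i)) = 0"
    "1 \<le> norm (\<Sum>i\<in>I. \<phi> i (d i))"
    "\<And>z. (\<And>i. i \<in> I \<Longrightarrow> z i \<in> W \<and> n (z i) \<le> r i) \<Longrightarrow> norm (\<Sum>i\<in>I. \<phi> i (z i)) \<le> 1"
proof -
  interpret vector_space s by fact
  define S where "S k f i = s k (f i)" for k and f :: "'i \<Rightarrow> 'v" and i
  have S_eq: "S = (\<lambda>k f i. s k (f i))" by (simp add: S_def fun_eq_iff)
  interpret S: vector_space S unfolding S_eq using vs by (rule vector_space_pointwise)
  define W' where "W' = {f. \<forall>i\<in>I. f i \<in> W}"
  \<comment> \<open>The inserted \<open>0\<close> makes \<open>p\<close> nonnegative on all tuples,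
    also where \<open>n\<close> is not controlled, and defined for empty \<open>I\<close>.\<close>
  define p where "p f = Max (insert 0 ((\<lambda>i. n (f i) / r i) ` I))" for f :: "'i \<Rightarrow> 'v"
  have p_le: "p f \<le> C \<longleftrightarrow> 0 \<le> C \<and> (\<forall>i\<in>I. n (f i) \<le> C * r i)" for f C
    using I r by (auto simp: p_def pos_divide_le_eq)
  have p_ge: "0 \<le> p f" "i \<in> I \<Longrightarrow> n (f i) \<le> p f * r i" for f i
    using p_le[of f "p f"] by auto
  have W': "S.subspace W'"
    unfolding W'_def S.subspace_def
    using subspace_0[OF W] subspace_add[OF W] subspace_scale[OF W] by (simp add: S_def)
  have n0: "n 0 \<le> 0"
    using n_scale[OF subspace_0[OF W], of 0] by simp
  obtain \<Lambda> :: "('i \<Rightarrow> 'v) \<Rightarrow> 'k" where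
    add: "\<And>x y. x \<in> W' \<Longrightarrow> y \<in> W' \<Longrightarrow> \<Lambda> (x + y) = \<Lambda> x + \<Lambda> y" and
    scale: "\<And>k x. x \<in> W' \<Longrightarrow> \<Lambda> (S k x) = k * \<Lambda> x" and
    le: "\<And>x. x \<in> W' \<Longrightarrow> norm (\<Lambda> x) \<le> p x" and
    null: "\<And>u. u \<in> U \<Longrightarrow> \<Lambda> u = 0" and ge: "1 \<le> norm (\<Lambda> d)"
  proof (rule hahn_banach_dist[OF S.vector_space_axioms W'])
    fix f g assume fg: "f \<in> W'" "g \<in> W'"
    show "p (f + g) \<le> p f + p g"
      unfolding p_le
    proof (intro conjI ballI)
      fix i assume i: "i \<in> I"
      have "n (f i + g i) \<le> n (f i) + n (g i)" using fg i by (intro n_add) (auto simp: W'_def)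
      then show "n ((f + g) i) \<le> (p f + p g) * r i"
        using p_ge(2)[OF i, of f] p_ge(2)[OF i, of g] by (simp add: distrib_right)
    qed (simp add: p_ge)
  next
    fix k f assume f: "f \<in> W'"
    show "p (S k f) \<le> norm k * p f"
      unfolding p_le
    proof (intro conjI ballI)
      fix i assume i: "i \<in> I"
      have "n (S k f i) \<le> norm k * n (f i)"
        using n_scale f i by (auto simp: W'_def S_def)
      also have "\<dots> \<le> norm k * (p f * r i)" using p_ge(2)[OF i, of f] by (intro mult_left_mono) auto
      finally show "n (S k f i) \<le> norm k * p f * r i" by (simp add: mult.assoc)
    qed (simp add: p_ge)
  next
    show "S.subspace U" using U by (simp add: S_eq)
    show "U \<subseteq> W'" "d \<in> W'" using UW d by (auto simp: W'_def)
    show "(0::real) \<le> 1" by simp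
    fix u assume "u \<in> U"
    then obtain i where i: "i \<in> I" "r i \<le> n (d i + u i)" using dist by blast
    have "1 * r i \<le> p (d + u) * r i" using i(2) p_ge(2)[OF i(1), of "d + u"] by simp
    then show "1 \<le> p (d + u)" using r[OF i(1)] mult_le_cancel_right_pos by blast
  qed blast
  define \<phi> where "\<phi> i x = \<Lambda> (\<lambda>j. if j = i then x else 0)" for i x
  have single: "(\<lambda>j. if j = i then x else 0) \<in> W'" if "x \<in> W" for i x
    using that subspace_0[OF W] by (simp add: W'_def)
  have lin: "linear_map_on s (*) W (\<phi> i)" for i
    unfolding linear_map_on_def
  proof (intro conjI ballI allI)
    fix x y assume xy: "x \<in> W" "y \<in> W"
    have "(\<lambda>j. if j = i then x + y else 0) = (\<lambda>j. if j = i then x else 0) + (\<lambda>j. if j = i then y else 0)"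
      by auto
    then show "\<phi> i (x + y) = \<phi> i x + \<phi> i y"
      unfolding \<phi>_def using add[OF single[OF xy(1)] single[OF xy(2)]] by simp
  next
    fix k x assume x: "x \<in> W"
    have "(\<lambda>j. if j = i then s k x else 0) = S k (\<lambda>j. if j = i then x else 0)"
      by (auto simp: S_def)
    then show "\<phi> i (s k x) = k * \<phi> i x"
      unfolding \<phi>_def using scale[OF single[OF x]] by simp
  qed
  have decomp: "\<Lambda> f = (\<Sum>i\<in>I. \<phi> i (f i))" if f: "f \<in> W'" for f
  proof -
    \<comment> \<open>Tuples are functions on the whole index type. Entries outside \<open>I\<close>
      have no influence on \<open>p\<close>, hence none on \<open>\<Lambda>\<close>.\<close>
    have zero: "\<Lambda> (\<lambda>j. if j \<in> I then 0 else g j) = 0" for g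
    proof -
      have "p (\<lambda>j. if j \<in> I then 0 else g j) \<le> 0" using n0 by (simp add: p_le)
      moreover have "(\<lambda>j. if j \<in> I then 0 else g j) \<in> W'" using subspace_0[OF W] by (simp add: W'_def)
      ultimately have "norm (\<Lambda> (\<lambda>j. if j \<in> I then 0 else g j)) \<le> 0" using le order.trans by blast
      then show ?thesis by simp
    qed
    have "\<Lambda> (\<lambda>j. if j \<in> J then f j else 0) = (\<Sum>i\<in>J. \<phi> i (f i))" if "finite J" "J \<subseteq> I" for J
      using that
    proof induction
      case empty
      then show ?case using zero[of "\<lambda>_. 0"] by simp
    next
      case (insert i J)
      have "(\<lambda>j. if j \<in> insert i J then f j else 0) =
          (\<lambda>j. if j = i then f i else 0) + (\<lambda>j. if j \<in> J then f j else 0)"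
        using insert.hyps by (auto simp: fun_eq_iff)
      moreover have "(\<lambda>j. if j \<in> J then f j else 0) \<in> W'" "f i \<in> W"
        using f insert.prems subspace_0[OF W] by (auto simp: W'_def)
      ultimately have "\<Lambda> (\<lambda>j. if j \<in> insert i J then f j else 0) =
          \<phi> i (f i) + \<Lambda> (\<lambda>j. if j \<in> J then f j else 0)"
        using add[OF single] by (simp add: \<phi>_def)
      then show ?case using insert by simp
    qed
    from this[OF I] have "\<Lambda> (\<lambda>j. if j \<in> I then f j else 0) = (\<Sum>i\<in>I. \<phi> i (f i))" by simp
    moreover have "f = (\<lambda>j. if j \<in> I then f j else 0) + (\<lambda>j. if j \<in> I then 0 else f j)"
      by (auto simp: fun_eq_iff)
    moreover have "(\<lambda>j. if j \<in> I then f j else 0) \<in> W'" "(\<lambda>j. if j \<in> I then 0 else f j) \<in> W'"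
      using f subspace_0[OF W] by (auto simp: W'_def)
    ultimately show ?thesis using add zero[of f] by (metis add_0_right)
  qed
  show thesis
  proof
    fix i assume i: "i \<in> I"
    show "linear_map_on s (*) W (\<phi> i)" by (rule lin)
    fix x assume x: "x \<in> W"
    have "0 \<le> n x"
      using n_add[OF subspace_0[OF W] subspace_0[OF W]] n_add[OF x subspace_scale[OF W x, of "-1"]]
        n_scale[OF x, of "-1"] by simp
    then have nr: "0 \<le> n x / r i" using r[OF i] by simp
    have "n 0 \<le> n x / r i * r j" if "j \<in> I" for j
      using n0 mult_nonneg_nonneg[OF nr less_imp_le[OF r[OF that]]] by simp
    then have "p (\<lambda>j. if j = i then x else 0) \<le> n x / r i"
      unfolding p_le using nr r[OF i] by simp
    then show "norm (\<phi> i x) \<le> n x / r i"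
      unfolding \<phi>_def by (rule order.trans[OF le[OF single[OF x]]])
  next
    fix u assume "u \<in> U" then show "(\<Sum>i\<in>I. \<phi> i (u i)) = 0"
      using null decomp[of u] UW by (simp add: W'_def)
  next
    show "1 \<le> norm (\<Sum>i\<in>I. \<phi> i (d i))"
      using ge decomp[of d] d by (simp add: W'_def)
  next
    fix z assume z: "\<And>i. i \<in> I \<Longrightarrow> z i \<in> W \<and> n (z i) \<le> r i"
    then have "z \<in> W'" "p z \<le> 1" by (auto simp: W'_def p_le)
    then show "norm (\<Sum>i\<in>I. \<phi> i (z i)) \<le> 1" using le decomp by (metis order.trans)
  qed
qed

section \<open>Biorthogonal systems\<close>

interpretation fs: vector_space fun_scale
  by (rule vector_space_fun_scale)

lemma fun_scale_apply: "fun_scale c f x = c * f x"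
  by (simp add: fun_scale_def)

lemma linear_map_on_sum_field:
  fixes f :: "'v::ab_group_add \<Rightarrow> 'k::field"
  assumes "vector_space s" "module.subspace s S" "linear_map_on s (*) S f" "\<And>i. i \<in> I \<Longrightarrow> x i \<in> S"
  shows "f (\<Sum>i\<in>I. s (c i) (x i)) = (\<Sum>i\<in>I. c i * f (x i))"
  using linear_map_on_sum[OF assms(1) vector_space_over_itself.vector_space_axioms assms(2-4)] .

text \<open>If the new \<open>f\<close> agreed everywhere with the combination \<open>f'\<close> of
  old functionals taking the same values at the \<open>e g\<close>, it would lie in their span. A
  point where they differ, corrected by the old \<open>e g\<close>, is killed by \<open>B\<close>
  but not by \<open>f\<close>. Independence is that of functions on the whole type; vanishing
  outside \<open>S\<close> ensures that the distinguishing point lies in \<open>S\<close>. The lemma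
  serves both functionals on the algebra and elements of the bidual acting on the dual.\<close>

lemma ex_dual_system:
  fixes s :: "'k::field \<Rightarrow> 'v::ab_group_add \<Rightarrow> 'v"
  assumes vs: "vector_space s" and S: "module.subspace s S"
    and "finite B" "fs.independent B"
    and "\<And>f. f \<in> B \<Longrightarrow> linear_map_on s (*) S f" "\<And>f x. f \<in> B \<Longrightarrow> x \<notin> S \<Longrightarrow> f x = 0"
  shows "\<exists>e. (\<forall>f\<in>B. e f \<in> S) \<and> (\<forall>f\<in>B. \<forall>g\<in>B. f (e g) = (if f = g then 1 else 0))"
  using assms(3-)
proof (induction B)
  case (insert f B)
  interpret vector_space s by fact
  have fB: "f \<notin> fs.span B" and B: "fs.independent B"
    using insert.prems(1) insert.hyps by (auto simp: fs.independent_insert)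
  have "\<exists>e. (\<forall>f\<in>B. e f \<in> S) \<and> (\<forall>f\<in>B. \<forall>g\<in>B. f (e g) = (if f = g then 1 else 0))"
    by (intro insert.IH B insert.prems insertI2)
  then obtain e where ee: "\<forall>f\<in>B. e f \<in> S" "\<forall>f\<in>B. \<forall>g\<in>B. f (e g) = (if f = g then 1 else 0)"
    by (elim exE conjE)
  note eS = ee(1)[rule_format] and e = ee(2)[rule_format]
  have lin: "g (\<Sum>h\<in>B. s (c h) (e h)) = (\<Sum>h\<in>B. c h * g (e h))" if "g \<in> insert f B" for g c
    using that by (intro linear_map_on_sum_field[OF vs S insert.prems(2)] eS)
  have diff: "g (x - y) = g x - g y" if "g \<in> insert f B" "x \<in> S" "y \<in> S" for g x y
    using linear_map_on_diff[OF vs vector_space_over_itself.vector_space_axioms S insert.prems(2)[OF that(1)] that(2,3)] .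
  define f' where "f' = (\<Sum>g\<in>B. fun_scale (f (e g)) g)"
  have f'_apply: "f' x = (\<Sum>g\<in>B. f (e g) * g x)" for x
    by (simp add: f'_def sum_fun_apply fun_scale_apply)
  have "f' \<in> fs.span B"
    unfolding f'_def by (intro fs.span_sum fs.span_scale fs.span_base)
  then obtain x where x: "f x \<noteq> f' x" using fB by (metis ext)
  have xS: "x \<in> S"
  proof (rule ccontr)
    assume "x \<notin> S"
    then have "f x = 0" "f' x = 0" using insert.prems(3) by (auto simp: f'_apply intro: sum.neutral)
    then show False using x by simp
  qed
  define y where "y = x - (\<Sum>g\<in>B. s (g x) (e g))"
  have sumS: "(\<Sum>g\<in>B. s (g x) (e g)) \<in> S"
    using eS by (intro subspace_sum[OF S] subspace_scale[OF S])
  have yS: "y \<in> S" unfolding y_def using xS sumS by (rule subspace_diff[OF S])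
  have gy: "g y = 0" if "g \<in> B" for g
  proof -
    have "g (\<Sum>h\<in>B. s (h x) (e h)) = (\<Sum>h\<in>B. h x * (if g = h then 1 else 0))"
      using that by (subst lin) (auto simp: e intro: sum.cong)
    also have "\<dots> = g x"
      using that insert.hyps(1) by (simp add: if_distrib[of "\<lambda>c. _ * c"] cong: if_cong)
    finally show ?thesis using that xS sumS by (simp add: y_def diff)
  qed
  have fy: "f y = f x - f' x"
    unfolding y_def diff[OF insertI1 xS sumS] using lin[of f "\<lambda>h. h x"] by (simp add: f'_apply mult.commute)
  define z where "z = s (1 / f y) y"
  have zS: "z \<in> S" unfolding z_def using yS by (rule subspace_scale[OF S])
  have scale: "g (s c v) = c * g v" if "g \<in> insert f B" "v \<in> S" for g c v
    using insert.prems(2) that unfolding linear_map_on_def by blast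
  have fz: "f z = 1" using x fy yS by (simp add: z_def scale)
  have gz: "g z = 0" if "g \<in> B" for g using that yS gy by (simp add: z_def scale)
  \<comment> \<open>Subtracting a multiple of \<open>z\<close> makes \<open>f\<close> vanish at the
    old vectors without changing the values of \<open>B\<close> there.\<close>
  define e' where "e' g = (if g = f then z else e g - s (f (e g)) z)" for g
  have "e' g \<in> S" if "g \<in> insert f B" for g
    using that zS eS by (auto simp: e'_def intro!: subspace_diff[OF S] subspace_scale[OF S])
  moreover have "g (e' h) = (if g = h then 1 else 0)" if "g \<in> insert f B" "h \<in> insert f B" for g h
    using that insert.hyps zS eS by (auto simp: e'_def fz gz e diff scale subspace_scale[OF S])
  ultimately show ?case by blast
qed simp

text \<open>Subtracting from \<open>x\<close> its component along the \<open>e f\<close> leaves a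
  point of the common kernel of \<open>B\<close>, where \<open>\<nu>\<close> vanishes. Thus a
  functional that vanishes on the common kernel is a combination of \<open>B\<close> on
  \<open>S\<close>, with coefficients read off at the \<open>e f\<close>.\<close>

lemma dual_system_expansion:
  assumes vs: "vector_space s" and S: "module.subspace s S" and B: "finite B"
    and lin: "\<And>f. f \<in> B \<Longrightarrow> linear_map_on s (*) S f" and \<nu>: "linear_map_on s (*) S \<nu>"
    and e: "\<And>f. f \<in> B \<Longrightarrow> e f \<in> S" "\<And>f g. f \<in> B \<Longrightarrow> g \<in> B \<Longrightarrow> f (e g) = (if f = g then 1 else 0)"
    and van: "\<And>x. x \<in> S \<Longrightarrow> (\<And>f. f \<in> B \<Longrightarrow> f x = 0) \<Longrightarrow> \<nu> x = (0::'k::field)" and x: "x \<in> S"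
  shows "\<nu> x = (\<Sum>f\<in>B. \<nu> (e f) * f x)"
proof -
  interpret vector_space s by fact
  define y where "y = (\<Sum>g\<in>B. s (g x) (e g))"
  have yS: "y \<in> S" unfolding y_def using e by (intro subspace_sum[OF S] subspace_scale[OF S])
  have eval: "h y = (\<Sum>g\<in>B. g x * h (e g))" if "linear_map_on s (*) S h" for h
    unfolding y_def by (intro linear_map_on_sum_field[OF vs S that] e(1))
  have diff: "h (x - y) = h x - h y" if "linear_map_on s (*) S h" for h
    using linear_map_on_diff[OF vs vector_space_over_itself.vector_space_axioms S that x yS] .
  have "\<nu> (x - y) = 0"
  proof (rule van)
    show "x - y \<in> S" using x yS by (rule subspace_diff[OF S])
    fix f assume f: "f \<in> B"
    have "f y = f x"
      using f B by (simp add: eval[OF lin[OF f]] e(2) if_distrib[of "\<lambda>c. _ * c"] cong: if_cong)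
    then show "f (x - y) = 0" by (simp add: diff lin f)
  qed
  then show ?thesis using diff[OF \<nu>] eval[OF \<nu>] by (simp add: mult.commute)
qed

section \<open>Dual, bidual and Arens products\<close>

lemma onorm_leI:
  assumes "bounded_linear f" "\<And>a. norm a \<le> 1 \<Longrightarrow> norm (f a) \<le> C"
  shows "onorm f \<le> C"
proof (rule onorm_bound)
  interpret bounded_linear f by fact
  show "0 \<le> C" using assms(2)[of 0] by (simp add: zero)
  fix a
  show "norm (f a) \<le> C * norm a"
  proof (cases "a = 0")
    case False
    have "norm (f (a /\<^sub>R norm a)) \<le> C"
      using False by (intro assms(2)) simp
    then show ?thesis using False by (simp add: scaleR field_simps)
  qed (simp add: zero)
qed

context banach_algebra_over
begin

lemma dual_bounded_linear: "\<mu> \<in> dual smul \<Longrightarrow> bounded_linear \<mu>"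
  by (simp add: dual_def)

lemma dual_linear: "\<mu> \<in> dual smul \<Longrightarrow> linear_map_on smul (*) UNIV \<mu>"
  unfolding dual_def linear_map_on_def by (auto simp: linear_simps)

lemma dual_add: "\<mu> \<in> dual smul \<Longrightarrow> \<mu> (a + b) = \<mu> a + \<mu> b"
  and dual_diff: "\<mu> \<in> dual smul \<Longrightarrow> \<mu> (a - b) = \<mu> a - \<mu> b"
  and dual_scale: "\<mu> \<in> dual smul \<Longrightarrow> \<mu> (smul c a) = c * \<mu> a"
  and dual_zero: "\<mu> \<in> dual smul \<Longrightarrow> \<mu> 0 = 0"
  unfolding dual_def by (auto simp: linear_simps)

lemma dual_sum: "\<mu> \<in> dual smul \<Longrightarrow> \<mu> (\<Sum>i\<in>I. f i) = (\<Sum>i\<in>I. \<mu> (f i))"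
  using bounded_linear.linear[OF dual_bounded_linear] linear_sum by blast

lemma dual_norm_le: "\<mu> \<in> dual smul \<Longrightarrow> norm (\<mu> a) \<le> onorm \<mu> * norm a"
  by (rule onorm[OF dual_bounded_linear])

lemma onorm_dual_nonneg: "\<mu> \<in> dual smul \<Longrightarrow> 0 \<le> onorm \<mu>"
  by (rule onorm_pos_le[OF dual_bounded_linear])

lemma dualI:
  assumes "\<And>a b. \<mu> (a + b) = \<mu> a + \<mu> b" "\<And>c a. \<mu> (smul c a) = c * \<mu> a"
    and "\<And>a. norm (\<mu> a) \<le> C * norm a"
  shows "\<mu> \<in> dual smul"
proof -
  have "\<mu> (r *\<^sub>R a) = r *\<^sub>R \<mu> a" for r a
    using assms(2)[of "of_real r" a] by (simp add: smul_of_real scaleR_conv_of_real)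
  then have "bounded_linear \<mu>"
    using assms by (intro bounded_linear_intro[of _ C]) (auto simp: mult.commute)
  then show ?thesis using assms(2) by (simp add: dual_def)
qed

lemma subspace_dual: "fs.subspace (dual smul)"
  unfolding fs.subspace_def
proof (intro conjI ballI allI)
  show "0 \<in> dual smul"
    by (rule dualI[of _ 0]) simp_all
next
  fix \<mu> \<nu> assume *: "\<mu> \<in> dual smul" "\<nu> \<in> dual smul"
  have le: "norm ((\<mu> + \<nu>) a) \<le> (onorm \<mu> + onorm \<nu>) * norm a" for a
    using dual_norm_le[OF *(1), of a] dual_norm_le[OF *(2), of a] norm_triangle_ineq[of "\<mu> a" "\<nu> a"]
    by (simp add: distrib_right)
  then show "\<mu> + \<nu> \<in> dual smul"
    using * by (intro dualI[OF _ _ le]) (simp_all add: dual_add dual_scale fun_scale_apply algebra_simps)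
next
  fix c \<mu> assume *: "\<mu> \<in> dual smul"
  have le: "norm (fun_scale c \<mu> a) \<le> (norm c * onorm \<mu>) * norm a" for a
    using dual_norm_le[OF *, of a] by (simp add: fun_scale_apply norm_mult mult.assoc mult_left_mono)
  then show "fun_scale c \<mu> \<in> dual smul"
    using * by (intro dualI[OF _ _ le]) (simp_all add: dual_add dual_scale fun_scale_apply algebra_simps)
qed

lemmas dual_plus = fs.subspace_add[OF subspace_dual]
  and dual_minus = fs.subspace_diff[OF subspace_dual]
  and dual_fun_scale = fs.subspace_scale[OF subspace_dual]

lemma onorm_add_le: "\<mu> \<in> dual smul \<Longrightarrow> \<nu> \<in> dual smul \<Longrightarrow> onorm (\<mu> + \<nu>) \<le> onorm \<mu> + onorm \<nu>"
  using onorm_triangle[OF dual_bounded_linear dual_bounded_linear] by (simp add: plus_fun_def)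

lemma onorm_fun_scale_le:
  assumes "\<mu> \<in> dual smul"
  shows "onorm (fun_scale c \<mu>) \<le> norm c * onorm \<mu>"
proof (rule onorm_bound)
  show "0 \<le> norm c * onorm \<mu>" using onorm_dual_nonneg[OF assms] by simp
  show "norm (fun_scale c \<mu> a) \<le> norm c * onorm \<mu> * norm a" for a
    using dual_norm_le[OF assms, of a] by (simp add: fun_scale_apply norm_mult mult.assoc mult_left_mono)
qed

lemma onorm_sum_le:
  assumes "\<And>i. i \<in> I \<Longrightarrow> f i \<in> dual smul"
  shows "onorm (\<Sum>i\<in>I. f i) \<le> (\<Sum>i\<in>I. onorm (f i))"
  using assms
proof (induction I rule: infinite_finite_induct)
  case (insert i I)
  then have "onorm (f i + (\<Sum>i\<in>I. f i)) \<le> onorm (f i) + onorm (\<Sum>i\<in>I. f i)"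
    by (intro onorm_add_le fs.subspace_sum[OF subspace_dual]) auto
  moreover have "onorm (\<Sum>i\<in>I. f i) \<le> (\<Sum>i\<in>I. onorm (f i))"
    by (intro insert.IH insert.prems insertI2)
  ultimately show ?case unfolding sum.insert[OF insert.hyps] by linarith
qed (simp_all add: zero_fun_def onorm_zero)

section \<open>The bidual, its norm and the canonical embedding\<close>

lemma bidual_linear: "\<Phi> \<in> bidual smul \<Longrightarrow> linear_map_on fun_scale (*) (dual smul) \<Phi>"
  by (simp add: bidual_def linear_map_on_def)

lemma bidual_add: "\<Phi> \<in> bidual smul \<Longrightarrow> \<mu> \<in> dual smul \<Longrightarrow> \<nu> \<in> dual smul \<Longrightarrow> \<Phi> (\<mu> + \<nu>) = \<Phi> \<mu> + \<Phi> \<nu>"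
  and bidual_scale: "\<Phi> \<in> bidual smul \<Longrightarrow> \<mu> \<in> dual smul \<Longrightarrow> \<Phi> (fun_scale c \<mu>) = c * \<Phi> \<mu>"
  and bidual_outside: "\<Phi> \<in> bidual smul \<Longrightarrow> \<mu> \<notin> dual smul \<Longrightarrow> \<Phi> \<mu> = 0"
  by (auto simp: bidual_def)

lemma bidual_diff:
  assumes "\<Phi> \<in> bidual smul" "\<mu> \<in> dual smul" "\<nu> \<in> dual smul"
  shows "\<Phi> (\<mu> - \<nu>) = \<Phi> \<mu> - \<Phi> \<nu>"
  using bidual_add[OF assms(1) dual_minus[OF assms(2,3)] assms(3)] by simp

lemma bidual_sum:
  assumes "\<Phi> \<in> bidual smul" "\<And>i. i \<in> I \<Longrightarrow> x i \<in> dual smul"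
  shows "\<Phi> (\<Sum>i\<in>I. fun_scale (c i) (x i)) = (\<Sum>i\<in>I. c i * \<Phi> (x i))"
  using assms
  by (intro linear_map_on_sum_field[OF vector_space_fun_scale subspace_dual bidual_linear])

lemma bidualI:
  assumes "\<And>\<mu> \<nu>. \<mu> \<in> dual smul \<Longrightarrow> \<nu> \<in> dual smul \<Longrightarrow> \<Phi> (\<mu> + \<nu>) = \<Phi> \<mu> + \<Phi> \<nu>"
    and "\<And>c \<mu>. \<mu> \<in> dual smul \<Longrightarrow> \<Phi> (fun_scale c \<mu>) = c * \<Phi> \<mu>"
    and "\<And>\<mu>. \<mu> \<in> dual smul \<Longrightarrow> norm (\<Phi> \<mu>) \<le> C * onorm \<mu>"
    and "\<And>\<mu>. \<mu> \<notin> dual smul \<Longrightarrow> \<Phi> \<mu> = 0"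
  shows "\<Phi> \<in> bidual smul"
  using assms unfolding bidual_def by blast

lemma bidual_norm_le:
  assumes "0 \<le> C" "\<And>\<mu>. \<mu> \<in> dual smul \<Longrightarrow> norm (\<Phi> \<mu>) \<le> C * onorm \<mu>"
  shows "bidual_norm smul \<Phi> \<le> C"
  unfolding bidual_norm_def
proof (rule cSUP_least)
  have "0 \<in> dual smul" using fs.subspace_0[OF subspace_dual] .
  moreover have "onorm (0 :: 'a \<Rightarrow> 'k) = 0" by (simp add: zero_fun_def onorm_zero)
  ultimately show "{\<mu> \<in> dual smul. onorm \<mu> \<le> 1} \<noteq> {}" by force
  fix \<mu> assume "\<mu> \<in> {\<mu> \<in> dual smul. onorm \<mu> \<le> 1}"
  then show "norm (\<Phi> \<mu>) \<le> C"
    using assms(2)[of \<mu>] mult_left_mono[of "onorm \<mu>" 1 C] assms(1) by simp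
qed

lemma bidual_norm_bound:
  assumes \<Phi>: "\<Phi> \<in> bidual smul" and \<mu>: "\<mu> \<in> dual smul"
  shows "norm (\<Phi> \<mu>) \<le> bidual_norm smul \<Phi> * onorm \<mu>"
proof -
  obtain B where B: "\<And>\<mu>. \<mu> \<in> dual smul \<Longrightarrow> norm (\<Phi> \<mu>) \<le> B * onorm \<mu>"
    using \<Phi> unfolding bidual_def by blast
  have bdd: "bdd_above ((\<lambda>\<mu>. norm (\<Phi> \<mu>)) ` {\<mu> \<in> dual smul. onorm \<mu> \<le> 1})"
  proof (rule bdd_aboveI2)
    fix \<mu> assume "\<mu> \<in> {\<mu> \<in> dual smul. onorm \<mu> \<le> 1}"
    then show "norm (\<Phi> \<mu>) \<le> \<bar>B\<bar>"
      using B[of \<mu>] onorm_dual_nonneg[of \<mu>] mult_mono[of B "\<bar>B\<bar>" "onorm \<mu>" 1] by fastforce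
  qed
  show ?thesis
  \<comment> \<open>A functional of norm zero cannot be normalised; for it the bound contained in
    the definition of \<open>bidual\<close> gives the value zero.\<close>
  proof (cases "onorm \<mu> = 0")
    case True
    then show ?thesis using B[OF \<mu>] by simp
  next
    case False
    then have pos: "onorm \<mu> > 0" using onorm_dual_nonneg[OF \<mu>] by simp
    let ?\<nu> = "fun_scale (of_real (1 / onorm \<mu>)) \<mu>"
    have "onorm ?\<nu> \<le> 1"
      using onorm_fun_scale_le[OF \<mu>, of "of_real (1 / onorm \<mu>)"] pos by (simp add: norm_divide)
    then have "norm (\<Phi> ?\<nu>) \<le> bidual_norm smul \<Phi>"
      unfolding bidual_norm_def using dual_fun_scale[OF \<mu>] by (intro cSUP_upper[OF _ bdd]) auto
    then show ?thesis using pos \<Phi> \<mu> by (simp add: bidual_scale norm_mult norm_divide field_simps)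
  qed
qed

lemma bidual_norm_nonneg:
  assumes "\<Phi> \<in> bidual smul" shows "0 \<le> bidual_norm smul \<Phi>"
proof (rule ccontr)
  assume neg: "\<not> 0 \<le> bidual_norm smul \<Phi>"
  have "norm (\<Phi> \<mu>) \<le> 0" if "\<mu> \<in> dual smul" for \<mu>
    using bidual_norm_bound[OF assms that] neg onorm_dual_nonneg[OF that]
      mult_nonpos_nonneg[of "bidual_norm smul \<Phi>" "onorm \<mu>"] by linarith
  then have zero: "\<Phi> \<mu> = 0" for \<mu> using bidual_outside[OF assms] by (cases "\<mu> \<in> dual smul") auto
  have "0 \<in> dual smul" using fs.subspace_0[OF subspace_dual] .
  moreover have "onorm (0 :: 'a \<Rightarrow> 'k) = 0" by (simp add: zero_fun_def onorm_zero)
  ultimately have "(\<lambda>\<mu>. norm (\<Phi> \<mu>)) ` {\<mu> \<in> dual smul. onorm \<mu> \<le> 1} = {0}"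
    using zero by (auto simp: image_iff intro!: exI[of _ "0 :: 'a \<Rightarrow> 'k"])
  then show False using neg by (simp add: bidual_norm_def)
qed

lemma subspace_bidual: "fs.subspace (bidual smul)"
  unfolding fs.subspace_def
proof (intro conjI ballI allI)
  show "0 \<in> bidual smul"
    by (rule bidualI[of _ 0]) simp_all
next
  fix \<Phi> \<Psi> assume *: "\<Phi> \<in> bidual smul" "\<Psi> \<in> bidual smul"
  have le: "norm ((\<Phi> + \<Psi>) \<mu>) \<le> (bidual_norm smul \<Phi> + bidual_norm smul \<Psi>) * onorm \<mu>" if "\<mu> \<in> dual smul" for \<mu>
    using bidual_norm_bound[OF *(1) that] bidual_norm_bound[OF *(2) that] norm_triangle_ineq[of "\<Phi> \<mu>" "\<Psi> \<mu>"]
    by (simp add: distrib_right)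
  then show "\<Phi> + \<Psi> \<in> bidual smul"
    using * by (intro bidualI[OF _ _ le]) (simp_all add: bidual_add bidual_scale bidual_outside algebra_simps)
next
  fix c \<Phi> assume *: "\<Phi> \<in> bidual smul"
  have le: "norm (fun_scale c \<Phi> \<mu>) \<le> (norm c * bidual_norm smul \<Phi>) * onorm \<mu>" if "\<mu> \<in> dual smul" for \<mu>
    using bidual_norm_bound[OF * that] by (simp add: fun_scale_apply norm_mult mult.assoc mult_left_mono)
  then show "fun_scale c \<Phi> \<in> bidual smul"
    using * by (intro bidualI[OF _ _ le]) (simp_all add: bidual_add bidual_scale bidual_outside fun_scale_apply algebra_simps)
qed

lemma bidual_norm_add_le:
  assumes "\<Phi> \<in> bidual smul" "\<Psi> \<in> bidual smul"
  shows "bidual_norm smul (\<Phi> + \<Psi>) \<le> bidual_norm smul \<Phi> + bidual_norm smul \<Psi>"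
proof (rule bidual_norm_le)
  fix \<mu> assume \<mu>: "\<mu> \<in> dual smul"
  show "norm ((\<Phi> + \<Psi>) \<mu>) \<le> (bidual_norm smul \<Phi> + bidual_norm smul \<Psi>) * onorm \<mu>"
    using bidual_norm_bound[OF assms(1) \<mu>] bidual_norm_bound[OF assms(2) \<mu>] norm_triangle_ineq[of "\<Phi> \<mu>" "\<Psi> \<mu>"]
    by (simp add: distrib_right)
qed (simp add: bidual_norm_nonneg assms)

lemma bidual_norm_scale_le:
  assumes "\<Phi> \<in> bidual smul"
  shows "bidual_norm smul (fun_scale c \<Phi>) \<le> norm c * bidual_norm smul \<Phi>"
proof (rule bidual_norm_le)
  fix \<mu> assume \<mu>: "\<mu> \<in> dual smul"
  show "norm (fun_scale c \<Phi> \<mu>) \<le> norm c * bidual_norm smul \<Phi> * onorm \<mu>"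
    using bidual_norm_bound[OF assms \<mu>] by (simp add: fun_scale_apply norm_mult mult.assoc mult_left_mono)
qed (simp add: bidual_norm_nonneg assms)

lemma bidual_norm_sum_le:
  assumes "\<And>i. i \<in> I \<Longrightarrow> f i \<in> bidual smul"
  shows "bidual_norm smul (\<Sum>i\<in>I. f i) \<le> (\<Sum>i\<in>I. bidual_norm smul (f i))"
  using assms
proof (induction I rule: infinite_finite_induct)
  case (insert i I)
  then have "bidual_norm smul (f i + (\<Sum>i\<in>I. f i)) \<le> bidual_norm smul (f i) + bidual_norm smul (\<Sum>i\<in>I. f i)"
    by (intro bidual_norm_add_le fs.subspace_sum[OF subspace_bidual]) auto
  moreover have "bidual_norm smul (\<Sum>i\<in>I. f i) \<le> (\<Sum>i\<in>I. bidual_norm smul (f i))"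
    by (intro insert.IH insert.prems insertI2)
  ultimately show ?case unfolding sum.insert[OF insert.hyps] by linarith
qed (simp_all add: bidual_norm_le)

lemma canonical_embedding_apply: "\<mu> \<in> dual smul \<Longrightarrow> canonical_embedding smul a \<mu> = \<mu> a"
  by (simp add: canonical_embedding_def)

lemma canonical_embedding_sum:
  "canonical_embedding smul (\<Sum>i\<in>I. smul (c i) (x i)) = (\<Sum>i\<in>I. fun_scale (c i) (canonical_embedding smul (x i)))"
  by (rule ext) (auto simp: canonical_embedding_def sum_fun_apply fun_scale_apply dual_sum dual_scale)

text \<open>Functionals separate points: Hahn--Banach with \<open>U = {0}\<close> gives a functional
  of norm at most one whose value at \<open>a - b\<close> is at least \<open>norm (a - b)\<close> in
  modulus.\<close>

lemma inj_canonical_embedding: "inj (canonical_embedding smul)"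
proof (rule injI, rule ccontr)
  fix a b assume eq: "canonical_embedding smul a = canonical_embedding smul b" and "a \<noteq> b"
  obtain \<phi> :: "'a \<Rightarrow> 'k" where \<phi>: "\<And>x y. x \<in> UNIV \<Longrightarrow> y \<in> UNIV \<Longrightarrow> \<phi> (x + y) = \<phi> x + \<phi> y"
    "\<And>k x. x \<in> UNIV \<Longrightarrow> \<phi> (smul k x) = k * \<phi> x" "\<And>x. x \<in> UNIV \<Longrightarrow> norm (\<phi> x) \<le> norm x"
    "norm (a - b) \<le> norm (\<phi> (a - b))"
    by (rule hahn_banach_dist[OF vector_space_axioms subspace_UNIV, of norm "{0}" "a - b" "norm (a - b)"])
      (auto simp: norm_triangle_ineq norm_smul subspace_0 subspace_single_0)
  then have "\<phi> \<in> dual smul" by (intro dualI[of _ 1]) auto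
  then have "\<phi> (a - b) = 0"
    using eq canonical_embedding_apply[of \<phi> a] canonical_embedding_apply[of \<phi> b] by (simp add: dual_diff)
  then show False using \<phi>(4) \<open>a \<noteq> b\<close> by simp
qed

section \<open>Module actions and the first Arens product\<close>

lemma dual_alg_dual:
  assumes "\<mu> \<in> dual smul"
  shows "dual_alg \<mu> a \<in> dual smul" "onorm (dual_alg \<mu> a) \<le> onorm \<mu> * norm a"
proof -
  have le: "norm (dual_alg \<mu> a b) \<le> (onorm \<mu> * norm a) * norm b" for b
    using dual_norm_le[OF assms, of "a * b"] norm_mult_ineq[of a b] onorm_dual_nonneg[OF assms]
    by (simp add: dual_alg_def mult.assoc) (metis mult_left_mono order.trans)
  then show "dual_alg \<mu> a \<in> dual smul"
    using assms by (intro dualI[OF _ _ le]) (simp_all add: dual_alg_def dual_add dual_scale distrib_left smul_mult_right)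
  show "onorm (dual_alg \<mu> a) \<le> onorm \<mu> * norm a"
    using le onorm_dual_nonneg[OF assms] by (intro onorm_bound) simp_all
qed

lemma alg_dual_dual:
  assumes "\<mu> \<in> dual smul"
  shows "alg_dual a \<mu> \<in> dual smul" "onorm (alg_dual a \<mu>) \<le> onorm \<mu> * norm a"
proof -
  have le: "norm (alg_dual a \<mu> b) \<le> (onorm \<mu> * norm a) * norm b" for b
    using dual_norm_le[OF assms, of "b * a"] norm_mult_ineq[of b a] onorm_dual_nonneg[OF assms]
    by (simp add: alg_dual_def mult.assoc mult.commute[of "norm a"]) (metis mult_left_mono order.trans)
  then show "alg_dual a \<mu> \<in> dual smul"
    using assms by (intro dualI[OF _ _ le]) (simp_all add: alg_dual_def dual_add dual_scale distrib_right smul_mult_left)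
  show "onorm (alg_dual a \<mu>) \<le> onorm \<mu> * norm a"
    using le onorm_dual_nonneg[OF assms] by (intro onorm_bound) simp_all
qed

lemma dual_alg_linear:
  assumes "\<mu> \<in> dual smul"
  shows "dual_alg \<mu> (a + b) = dual_alg \<mu> a + dual_alg \<mu> b"
    "dual_alg \<mu> (smul c a) = fun_scale c (dual_alg \<mu> a)"
  using assms by (auto simp: dual_alg_def fun_scale_apply dual_add dual_scale distrib_right smul_mult_left)

lemma alg_dual_linear:
  assumes "\<mu> \<in> dual smul"
  shows "alg_dual (a + b) \<mu> = alg_dual a \<mu> + alg_dual b \<mu>"
    "alg_dual (smul c a) \<mu> = fun_scale c (alg_dual a \<mu>)"
  using assms by (auto simp: alg_dual_def fun_scale_apply dual_add dual_scale distrib_left smul_mult_right)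

lemma bidual_dual_dual:
  assumes \<Phi>: "\<Phi> \<in> bidual smul" and \<mu>: "\<mu> \<in> dual smul"
  shows "bidual_dual \<Phi> \<mu> \<in> dual smul" "onorm (bidual_dual \<Phi> \<mu>) \<le> bidual_norm smul \<Phi> * onorm \<mu>"
proof -
  have le: "norm (bidual_dual \<Phi> \<mu> a) \<le> (bidual_norm smul \<Phi> * onorm \<mu>) * norm a" for a
    unfolding bidual_dual_def mult.assoc
    using dual_alg_dual[OF \<mu>, of a] bidual_norm_nonneg[OF \<Phi>]
    by (intro order.trans[OF bidual_norm_bound[OF \<Phi>]] mult_left_mono)
  then show "bidual_dual \<Phi> \<mu> \<in> dual smul"
    using \<Phi> \<mu> by (intro dualI[OF _ _ le])
      (simp_all add: bidual_dual_def dual_alg_linear dual_alg_dual bidual_add bidual_scale)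
  show "onorm (bidual_dual \<Phi> \<mu>) \<le> bidual_norm smul \<Phi> * onorm \<mu>"
    using le onorm_dual_nonneg[OF \<mu>] bidual_norm_nonneg[OF \<Phi>] by (intro onorm_bound) simp_all
qed

lemma dual_bidual_dual:
  assumes \<Phi>: "\<Phi> \<in> bidual smul" and \<mu>: "\<mu> \<in> dual smul"
  shows "dual_bidual \<mu> \<Phi> \<in> dual smul"
proof -
  have le: "norm (dual_bidual \<mu> \<Phi> a) \<le> (bidual_norm smul \<Phi> * onorm \<mu>) * norm a" for a
    unfolding dual_bidual_def mult.assoc
    using alg_dual_dual[OF \<mu>, of a] bidual_norm_nonneg[OF \<Phi>]
    by (intro order.trans[OF bidual_norm_bound[OF \<Phi>]] mult_left_mono)
  then show "dual_bidual \<mu> \<Phi> \<in> dual smul"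
    using \<Phi> \<mu> by (intro dualI[OF _ _ le])
      (simp_all add: dual_bidual_def alg_dual_linear alg_dual_dual bidual_add bidual_scale)
qed

lemma dual_alg_add_left: "dual_alg (\<mu> + \<nu>) a = dual_alg \<mu> a + dual_alg \<nu> a"
  and dual_alg_scale_left: "dual_alg (fun_scale c \<mu>) a = fun_scale c (dual_alg \<mu> a)"
  by (auto simp: dual_alg_def fun_scale_apply)

lemma bidual_dual_add_right:
  "\<Phi> \<in> bidual smul \<Longrightarrow> \<mu> \<in> dual smul \<Longrightarrow> \<nu> \<in> dual smul \<Longrightarrow>
     bidual_dual \<Phi> (\<mu> + \<nu>) = bidual_dual \<Phi> \<mu> + bidual_dual \<Phi> \<nu>"
  and bidual_dual_scale_right:
  "\<Phi> \<in> bidual smul \<Longrightarrow> \<mu> \<in> dual smul \<Longrightarrow>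
     bidual_dual \<Phi> (fun_scale c \<mu>) = fun_scale c (bidual_dual \<Phi> \<mu>)"
  by (auto simp: bidual_dual_def dual_alg_add_left dual_alg_scale_left fun_scale_apply
      bidual_add bidual_scale dual_alg_dual)

lemma bidual_dual_add_left: "bidual_dual (\<Phi> + \<Psi>) \<mu> = bidual_dual \<Phi> \<mu> + bidual_dual \<Psi> \<mu>"
  and bidual_dual_scale_left: "bidual_dual (fun_scale c \<Phi>) \<mu> = fun_scale c (bidual_dual \<Phi> \<mu>)"
  by (auto simp: bidual_dual_def fun_scale_apply)

lemma arens_box_bidual:
  assumes \<Phi>: "\<Phi> \<in> bidual smul" and \<Psi>: "\<Psi> \<in> bidual smul"
  shows "arens_box smul \<Phi> \<Psi> \<in> bidual smul"
proof (rule bidualI)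
  fix \<mu> assume \<mu>: "\<mu> \<in> dual smul"
  have "norm (arens_box smul \<Phi> \<Psi> \<mu>) \<le> bidual_norm smul \<Phi> * onorm (bidual_dual \<Psi> \<mu>)"
    using bidual_norm_bound[OF \<Phi> bidual_dual_dual(1)[OF \<Psi> \<mu>]] \<mu> by (simp add: arens_box_def)
  also have "\<dots> \<le> bidual_norm smul \<Phi> * (bidual_norm smul \<Psi> * onorm \<mu>)"
    by (intro mult_left_mono bidual_dual_dual(2) bidual_norm_nonneg assms \<mu>)
  finally show "norm (arens_box smul \<Phi> \<Psi> \<mu>) \<le> (bidual_norm smul \<Phi> * bidual_norm smul \<Psi>) * onorm \<mu>"
    by (simp add: mult.assoc)
qed (use assms in \<open>simp_all add: arens_box_def dual_plus dual_fun_scale bidual_dual_add_right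
    bidual_dual_scale_right bidual_add bidual_scale bidual_dual_dual\<close>)

lemma arens_box_add_left: "arens_box smul (\<Phi> + \<Phi>') \<Psi> = arens_box smul \<Phi> \<Psi> + arens_box smul \<Phi>' \<Psi>"
  and arens_box_scale_left: "arens_box smul (fun_scale c \<Phi>) \<Psi> = fun_scale c (arens_box smul \<Phi> \<Psi>)"
  by (auto simp: arens_box_def fun_scale_apply)

lemma arens_box_add_right:
  "\<Phi> \<in> bidual smul \<Longrightarrow> \<Psi> \<in> bidual smul \<Longrightarrow> \<Psi>' \<in> bidual smul \<Longrightarrow>
     arens_box smul \<Phi> (\<Psi> + \<Psi>') = arens_box smul \<Phi> \<Psi> + arens_box smul \<Phi> \<Psi>'"
  and arens_box_scale_right:
  "\<Phi> \<in> bidual smul \<Longrightarrow> \<Psi> \<in> bidual smul \<Longrightarrow>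
     arens_box smul \<Phi> (fun_scale c \<Psi>) = fun_scale c (arens_box smul \<Phi> \<Psi>)"
  by (auto simp: arens_box_def fun_scale_apply bidual_dual_add_left bidual_dual_scale_left
      bidual_add bidual_scale bidual_dual_dual)

text \<open>The norm of \<open>\<mu>\<close> is nearly attained on the unit ball. The slack sits in
  the factor \<open>n + \<eta>\<close>, so the estimate also covers \<open>n = 0\<close> and
  \<open>\<mu> = 0\<close>; the value is made real and nonnegative so that no cancellation occurs
  when such values are summed.\<close>

lemma ex_near_norming:
  assumes \<mu>: "\<mu> \<in> dual smul" and "0 \<le> n" "0 < \<eta>"
  shows "\<exists>a v. norm a \<le> 1 \<and> 0 \<le> v \<and> \<mu> a = of_real v \<and> n * onorm \<mu> \<le> (n + \<eta>) * v"
proof -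
  have "\<exists>a. norm a \<le> 1 \<and> n * onorm \<mu> \<le> (n + \<eta>) * norm (\<mu> a)"
  proof (rule ccontr)
    assume "\<not> ?thesis"
    then have small: "(n + \<eta>) * norm (\<mu> a) < n * onorm \<mu>" if "norm a \<le> 1" for a
      using that by (meson not_le)
    then have "norm (\<mu> a) \<le> n * onorm \<mu> / (n + \<eta>)" if "norm a \<le> 1" for a
      using that assms by (force simp: field_simps)
    then have "onorm \<mu> \<le> n * onorm \<mu> / (n + \<eta>)"
      by (rule onorm_leI[OF dual_bounded_linear[OF \<mu>]])
    then have "onorm \<mu> * (n + \<eta>) \<le> n * onorm \<mu>"
      using assms by (simp add: pos_le_divide_eq)
    then have "\<eta> * onorm \<mu> \<le> 0" by (simp add: algebra_simps)
    then have "onorm \<mu> = 0" using assms onorm_dual_nonneg[OF \<mu>] by (simp add: mult_le_0_iff)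
    then show False using small[of 0] dual_zero[OF \<mu>] by simp
  qed
  then obtain a where a: "norm a \<le> 1" "n * onorm \<mu> \<le> (n + \<eta>) * norm (\<mu> a)" by blast
  show ?thesis
  proof (cases "\<mu> a = 0")
    case True
    then show ?thesis using a by (intro exI[of _ a] exI[of _ 0]) simp
  next
    case False
    \<comment> \<open>The unimodular factor that rotates \<open>\<mu> a\<close> onto its
      modulus.\<close>
    define c where "c = of_real (norm (\<mu> a)) / \<mu> a"
    have "norm c = 1" using False by (simp add: c_def norm_divide)
    moreover have "\<mu> (smul c a) = of_real (norm (\<mu> a))"
      using False by (simp add: dual_scale[OF \<mu>] c_def)
    ultimately show ?thesis
      using a by (intro exI[of _ "smul c a"] exI[of _ "norm (\<mu> a)"]) (simp add: norm_smul)
  qed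
qed

text \<open>Norm bounds concern vectors of the algebra, module approximations concern functionals.
  Placing both in the product of the algebra with its dual lets one separation theorem for tuples
  over a single space treat them together.\<close>

definition pair_scale :: "'k \<Rightarrow> 'a \<times> ('a \<Rightarrow> 'k) \<Rightarrow> 'a \<times> ('a \<Rightarrow> 'k)" where
  "pair_scale k z = (smul k (fst z), fun_scale k (snd z))"

lemma vector_space_pair_scale: "vector_space pair_scale"
  by unfold_locales
    (auto simp: pair_scale_def scale_right_distrib scale_left_distrib fs.scale_right_distrib fs.scale_left_distrib)

lemma subspace_pair_dual: "module.subspace pair_scale (UNIV \<times> dual smul)"
proof -
  interpret ps: vector_space pair_scale by (rule vector_space_pair_scale)
  show ?thesis
    unfolding ps.subspace_def
    using fs.subspace_0[OF subspace_dual] dual_plus dual_fun_scale by (auto simp: pair_scale_def zero_prod_def)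
qed

text \<open>
  The unknown operator is \<open>\<alpha> + v\<close>, where \<open>\<alpha>\<close> satisfies the exact conditions and \<open>v\<close> the
  homogeneous ones. If no \<open>v\<close> satisfies the norm conditions, a separating functional on the tuples
  is given by \<open>l x\<close> in the dual and \<open>L q\<close> in the bidual; the functional \<open>\<nu> b\<close> through which
  it depends on the \<open>b\<close>-th coordinate of the operator annihilates the homogeneous solutions, hence
  takes the same value at \<open>\<alpha> b\<close> as \<open>b\<close> takes at \<open>\<nu> b\<close>. With Arens regularity the
  separating functional then reduces to \<open>\<Sum>x. x (l x)\<close>, which is too small.
\<close>

lemma ex_local_reflexivity_map:
  defines "\<kappa> \<equiv> canonical_embedding smul"
  assumes reg: "arens_regular smul"
    and B: "finite B" "fs.independent B" "B \<subseteq> bidual smul"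
    and B\<kappa>: "\<forall>a. \<kappa> a \<in> fs.span B \<longrightarrow> \<kappa> a \<in> fs.span (B \<inter> range \<kappa>)"
    and F: "finite F" "fs.independent F" "F \<subseteq> dual smul"
    and X: "finite X" "X \<subseteq> fs.span B" and P: "finite P" "P \<subseteq> dual smul \<times> fs.span B"
    and \<eta>: "\<eta> > 0"
  shows "\<exists>T. linear_map_on fun_scale smul (fs.span B) T \<and>
    (\<forall>\<Phi>\<in>fs.span B. \<forall>\<mu>\<in>fs.span F. \<Phi> \<mu> = \<mu> (T \<Phi>)) \<and>
    (\<forall>a. \<kappa> a \<in> fs.span B \<longrightarrow> T (\<kappa> a) = a) \<and>
    (\<forall>x\<in>X. norm (T x) < bidual_norm smul x + \<eta>) \<and>
    (\<forall>(\<mu>, \<Phi>)\<in>P. onorm (dual_alg \<mu> (T \<Phi>) - dual_bidual \<mu> \<Phi>) < \<eta>)"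
proof -
  define rep where "rep b \<Phi> = fs.representation B \<Phi> b" for b \<Phi>
  define T where "T a \<Phi> = (\<Sum>b\<in>B. smul (rep b \<Phi>) (a b))" for a :: "(('a \<Rightarrow> 'k) \<Rightarrow> 'k) \<Rightarrow> 'a" and \<Phi>
  have spanB: "fs.span B \<subseteq> bidual smul" using fs.span_minimal[OF B(3) subspace_bidual] .
  have spanF: "fs.span F \<subseteq> dual smul" using fs.span_minimal[OF F(3) subspace_dual] .
  have rep_expand: "\<Phi> = (\<Sum>b\<in>B. fun_scale (rep b \<Phi>) b)" if "\<Phi> \<in> fs.span B" for \<Phi>
    unfolding rep_def using fs.sum_representation_eq[OF B(2) that B(1) order.refl] by simp
  have rep_eval: "\<Phi> \<mu> = (\<Sum>b\<in>B. rep b \<Phi> * b \<mu>)" if "\<Phi> \<in> fs.span B" for \<Phi> \<mu>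
    by (subst rep_expand[OF that]) (simp add: sum_fun_apply fun_scale_apply)
  have dual_T: "\<mu> (T a \<Phi>) = (\<Sum>b\<in>B. rep b \<Phi> * \<mu> (a b))" if "\<mu> \<in> dual smul" for \<mu> a \<Phi>
    by (simp add: T_def dual_sum[OF that] dual_scale[OF that])
  have T_add: "T (\<lambda>b. a b + a' b) \<Phi> = T a \<Phi> + T a' \<Phi>" for a a' \<Phi>
    by (simp add: T_def scale_right_distrib sum.distrib)
  have T_scale: "T (\<lambda>b. smul c (a b)) \<Phi> = smul c (T a \<Phi>)" for a c \<Phi>
    by (simp add: T_def scale_sum_right mult.commute)
  have T_linear: "linear_map_on fun_scale smul (fs.span B) (T a)" for a
    unfolding linear_map_on_def T_def rep_def
    by (auto simp: fs.representation_add[OF B(2)] fs.representation_scale[OF B(2)] scale_left_distrib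
        sum.distrib scale_sum_right)
  have T_basis: "T a b = a b" if "b \<in> B" for a b
    using that B(1) by (simp add: T_def rep_def fs.representation_basis[OF B(2)] if_distrib[of "\<lambda>c. smul c _"] cong: if_cong)
  have "\<exists>e. (\<forall>f\<in>F. e f \<in> UNIV) \<and> (\<forall>f\<in>F. \<forall>g\<in>F. f (e g) = (if f = g then 1 else 0))"
    using F dual_linear by (intro ex_dual_system[OF vector_space_axioms subspace_UNIV]) auto
  then obtain e where e: "\<And>f g. f \<in> F \<Longrightarrow> g \<in> F \<Longrightarrow> f (e g) = (if f = g then 1 else 0)"
    by (elim exE conjE) simp
  \<comment> \<open>On the range of \<open>\<kappa>\<close> condition (2) forces the value, which
    satisfies (1) automatically; elsewhere the vectors biorthogonal to \<open>F\<close> realise the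
    prescribed values \<open>b f\<close>.\<close>
  define \<alpha> where "\<alpha> b = (if b \<in> range \<kappa> then inv \<kappa> b else \<Sum>f\<in>F. smul (b f) (e f))" for b
  have \<alpha>_range: "\<kappa> (\<alpha> b) = b" if "b \<in> range \<kappa>" for b
    using that by (simp add: \<alpha>_def f_inv_into_f)
  have \<alpha>_F: "f (\<alpha> b) = b f" if "b \<in> B" "f \<in> F" for b f
  proof (cases "b \<in> range \<kappa>")
    case True
    have "f \<in> dual smul" using that F by blast
    then show ?thesis using \<alpha>_range[OF True] canonical_embedding_apply[of f "\<alpha> b"] by (simp add: \<kappa>_def)
  next
    case False
    have f: "f \<in> dual smul" using that F by blast
    have "f (\<alpha> b) = (\<Sum>g\<in>F. b g * (if f = g then 1 else 0))"
      using False that by (simp add: \<alpha>_def dual_sum[OF f] dual_scale[OF f] e)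
    then show ?thesis using that F(1) by (simp add: if_distrib[of "\<lambda>c. _ * c"] cong: if_cong)
  qed
  define A where "A = {v. \<forall>b. (b \<in> range \<kappa> \<longrightarrow> v b = 0) \<and> (b \<notin> range \<kappa> \<longrightarrow> (\<forall>f\<in>F. f (v b) = 0))}"
  have AI: "v \<in> A" if "\<And>b. b \<in> range \<kappa> \<Longrightarrow> v b = 0" "\<And>b f. b \<notin> range \<kappa> \<Longrightarrow> f \<in> F \<Longrightarrow> f (v b) = 0" for v
    using that unfolding A_def by blast
  have A0: "v b = 0" if "v \<in> A" "b \<in> range \<kappa>" for v b
    using that unfolding A_def by blast
  have A_F: "f (v b) = 0" if "v \<in> A" "f \<in> F" for v b f
    using that F(3) dual_zero[of f] unfolding A_def by (cases "b \<in> range \<kappa>") auto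
  have A_add: "(\<lambda>b. v b + w b) \<in> A" if "v \<in> A" "w \<in> A" for v w
  proof (rule AI)
    fix b f assume "f \<in> F"
    then show "f (v b + w b) = 0" using that A_F[of v f b] A_F[of w f b] F(3) dual_add[of f] by auto
  qed (simp add: A0 that)
  have A_scale: "(\<lambda>b. smul c (v b)) \<in> A" if "v \<in> A" for c v
  proof (rule AI)
    fix b f assume "f \<in> F"
    then show "f (smul c (v b)) = 0" using that A_F[of v f b] F(3) dual_scale[of f] by auto
  qed (simp add: A0 that)
  have A_zero: "(\<lambda>b. 0) \<in> A"
    using F(3) dual_zero by (intro AI) auto
  define I where "I = X <+> P"
  \<comment> \<open>\<open>D i + R v i\<close> is the quantity whose norm must stay below
    \<open>r i\<close> for the operator given by \<open>\<alpha> + v\<close>: its value at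
    \<open>x\<close> for \<open>Inl x\<close>, its module error for \<open>Inr q\<close>. The part
    linear in \<open>v\<close> is \<open>R v i\<close>.\<close>
  define R where "R v i = (case i of Inl x \<Rightarrow> (T v x, 0)
      | Inr q \<Rightarrow> (0, dual_alg (fst q) (T v (snd q))))"
    for v and i :: "_ + ('a \<Rightarrow> 'k) \<times> (('a \<Rightarrow> 'k) \<Rightarrow> 'k)"
  define D where "D i = (case i of Inl x \<Rightarrow> (T \<alpha> x, 0)
      | Inr q \<Rightarrow> (0, dual_alg (fst q) (T \<alpha> (snd q)) - dual_bidual (fst q) (snd q)))" for i
  define r where "r i = (case i of Inl x \<Rightarrow> bidual_norm smul x + \<eta> | Inr _ \<Rightarrow> \<eta>)" for i :: "_ + ('a \<Rightarrow> 'k) \<times> (('a \<Rightarrow> 'k) \<Rightarrow> 'k)"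
  \<comment> \<open>Each entry that occurs has one zero component, so the sum norm is just the norm
    of the other one.\<close>
  define n where "n z = norm (fst z) + onorm (snd z)" for z :: "'a \<times> ('a \<Rightarrow> 'k)"
  define W where "W = (UNIV :: 'a set) \<times> dual smul"
  have onorm0: "onorm (0 :: 'a \<Rightarrow> 'k) = 0" by (simp add: zero_fun_def onorm_zero)
  have dual0: "0 \<in> dual smul" using fs.subspace_0[OF subspace_dual] .
  have PD: "fst q \<in> dual smul" "snd q \<in> bidual smul" "snd q \<in> fs.span B" if "q \<in> P" for q
    using P(2) that spanB by (auto dest!: subsetD)
  have XD: "x \<in> bidual smul" "x \<in> fs.span B" if "x \<in> X" for x
    using X(2) that spanB by (auto dest!: subsetD)
  have "\<exists>v\<in>A. \<forall>i\<in>I. n (D i + R v i) < r i"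
  proof (rule ccontr)
    assume contra: "\<not> ?thesis"
    \<comment> \<open>Entries outside \<open>I\<close> are left free, because \<open>R\<close> is
      known to be linear in \<open>v\<close> only at indices in \<open>I\<close>, where the
      functionals of the pairs belong to the dual.\<close>
    define U where "U = {u. \<exists>v\<in>A. \<forall>i\<in>I. u i = R v i}"
    interpret fps: vector_space "\<lambda>k f i. pair_scale k (f i)"
      by (rule vector_space_pointwise[OF vector_space_pair_scale])
    have R_add: "R (\<lambda>b. v b + w b) i = R v i + R w i" if "i \<in> I" for v w i
      using that PD(1) by (auto simp: R_def I_def T_add dual_alg_linear)
    have R_scale: "R (\<lambda>b. smul c (v b)) i = pair_scale c (R v i)" if "i \<in> I" for c v i
      using that PD(1) by (auto simp: R_def I_def T_scale dual_alg_linear pair_scale_def fs.scale_zero_right)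
    have R_W: "R v i \<in> W" if "i \<in> I" for v i
      using that PD(1) dual0 by (auto simp: R_def I_def W_def dual_alg_dual)
    have R_zero: "R (\<lambda>b. 0) i = 0" if "i \<in> I" for i
      using R_scale[OF that, of 0 "\<lambda>b. 0"] by (simp add: pair_scale_def prod_eq_iff fs.scale_zero_left)
    have U: "fps.subspace U"
      unfolding fps.subspace_def
    proof (intro conjI ballI allI)
      show "0 \<in> U" unfolding U_def using A_zero R_zero by (auto intro!: bexI[of _ "\<lambda>b. 0"])
    next
      fix u u' assume "u \<in> U" "u' \<in> U"
      then obtain v w where "v \<in> A" "w \<in> A" "\<forall>i\<in>I. u i = R v i" "\<forall>i\<in>I. u' i = R w i"
        unfolding U_def by blast
      then show "u + u' \<in> U"
        unfolding U_def using A_add R_add by (auto intro!: bexI[of _ "\<lambda>b. v b + w b"])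
    next
      fix c u assume "u \<in> U"
      then obtain v where "v \<in> A" "\<forall>i\<in>I. u i = R v i"
        unfolding U_def by blast
      then show "(\<lambda>i. pair_scale c (u i)) \<in> U"
        unfolding U_def using A_scale R_scale by (auto intro!: bexI[of _ "\<lambda>b. smul c (v b)"])
    qed
    obtain \<phi> where \<phi>_lin: "\<And>i. i \<in> I \<Longrightarrow> linear_map_on pair_scale (*) W (\<phi> i)"
      and \<phi>_le: "\<And>i x. i \<in> I \<Longrightarrow> x \<in> W \<Longrightarrow> norm (\<phi> i x) \<le> n x / r i"
      and \<phi>_U: "\<And>u. u \<in> U \<Longrightarrow> (\<Sum>i\<in>I. \<phi> i (u i)) = 0"
      and \<phi>_D: "1 \<le> norm (\<Sum>i\<in>I. \<phi> i (D i))"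
      and \<phi>_ball: "\<And>z. (\<And>i. i \<in> I \<Longrightarrow> z i \<in> W \<and> n (z i) \<le> r i) \<Longrightarrow> norm (\<Sum>i\<in>I. \<phi> i (z i)) \<le> 1"
    proof (rule hahn_banach_tuples[OF vector_space_pair_scale, of W n I r U D])
      show "module.subspace pair_scale W" unfolding W_def by (rule subspace_pair_dual)
      show "n (x + y) \<le> n x + n y" if "x \<in> W" "y \<in> W" for x y
        using that onorm_add_le[of "snd x" "snd y"] norm_triangle_ineq[of "fst x" "fst y"]
        by (auto simp: n_def W_def)
      show "n (pair_scale k x) \<le> norm k * n x" if "x \<in> W" for k x
        using that onorm_fun_scale_le[of "snd x" k] by (auto simp: n_def W_def pair_scale_def norm_smul distrib_left)
      show "finite I" using X P by (simp add: I_def)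
      show "r i > 0" if "i \<in> I" for i
        using that \<eta> by (auto simp: I_def r_def intro!: add_nonneg_pos bidual_norm_nonneg XD(1))
      show "fps.subspace U" by (rule U)
      show "u i \<in> W" if "u \<in> U" "i \<in> I" for u i using that R_W by (auto simp: U_def)
      show "D i \<in> W" if "i \<in> I" for i
        using that PD dual0 by (auto simp: D_def I_def W_def dual_alg_dual dual_bidual_dual intro!: dual_minus)
      show "\<exists>i\<in>I. r i \<le> n (D i + u i)" if "u \<in> U" for u
        using that contra unfolding U_def by (force simp: not_less)
    qed blast
    define l where "l x a = \<phi> (Inl x) (a, 0)" for x a
    \<comment> \<open>The value zero outside the dual is what the encoding of the bidual
      prescribes.\<close>
    define L where "L q w = (if w \<in> dual smul then \<phi> (Inr q) (0, w) else 0)" for q w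
    have l: "l x \<in> dual smul" if x: "x \<in> X" for x
    proof (rule dualI)
      have i: "Inl x \<in> I" using x by (simp add: I_def InlI)
      note lin = \<phi>_lin[OF i, unfolded linear_map_on_def]
      show "l x (a + b) = l x a + l x b" for a b
        using lin[THEN conjunct1, rule_format, of "(a, 0)" "(b, 0)"] dual0 by (simp add: l_def W_def)
      show "l x (smul c a) = c * l x a" for c a
        using lin[THEN conjunct2, rule_format, of "(a, 0)" c] dual0
        by (simp add: l_def W_def pair_scale_def fs.scale_zero_right)
      show "norm (l x a) \<le> 1 / r (Inl x) * norm a" for a
        using \<phi>_le[OF i, of "(a, 0)"] dual0 by (simp add: l_def W_def n_def onorm0)
    qed
    have L: "L q \<in> bidual smul" if q: "q \<in> P" for q
    proof (rule bidualI)
      have i: "Inr q \<in> I" using q by (simp add: I_def InrI)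
      note lin = \<phi>_lin[OF i, unfolded linear_map_on_def]
      show "L q (\<mu> + \<nu>) = L q \<mu> + L q \<nu>" if "\<mu> \<in> dual smul" "\<nu> \<in> dual smul" for \<mu> \<nu>
        using lin[THEN conjunct1, rule_format, of "(0, \<mu>)" "(0, \<nu>)"] dual_plus that by (simp add: L_def W_def)
      show "L q (fun_scale c \<mu>) = c * L q \<mu>" if "\<mu> \<in> dual smul" for c \<mu>
        using lin[THEN conjunct2, rule_format, of "(0, \<mu>)" c] dual_fun_scale that
        by (simp add: L_def W_def pair_scale_def)
      show "norm (L q \<mu>) \<le> 1 / \<eta> * onorm \<mu>" if "\<mu> \<in> dual smul" for \<mu>
        using \<phi>_le[OF i, of "(0, \<mu>)"] that by (simp add: L_def W_def n_def r_def)
    qed (simp add: L_def)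
    have \<phi>_sum: "(\<Sum>i\<in>I. \<phi> i (case i of Inl x \<Rightarrow> (a x, 0) | Inr q \<Rightarrow> (0, w q))) =
        (\<Sum>x\<in>X. l x (a x)) + (\<Sum>q\<in>P. L q (w q))" if "\<And>q. q \<in> P \<Longrightarrow> w q \<in> dual smul" for a w
      unfolding I_def using that X(1) P(1) by (simp add: sum.Plus l_def L_def)
    \<comment> \<open>Moves the operator out of the module action: \<open>L q\<close> at
      \<open>\<mu> \<cdot> a\<close> is \<open>m q\<close> at \<open>a\<close>.\<close>
    define m where "m q = bidual_dual (L q) (fst q)" for q
    have m: "m q \<in> dual smul" if "q \<in> P" for q
      unfolding m_def using that L PD bidual_dual_dual by blast
    define \<nu> where "\<nu> b = (\<Sum>x\<in>X. fun_scale (rep b x) (l x)) + (\<Sum>q\<in>P. fun_scale (rep b (snd q)) (m q))" for b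
    have \<nu>: "\<nu> b \<in> dual smul" for b
      unfolding \<nu>_def using l m by (intro dual_plus fs.subspace_sum[OF subspace_dual] dual_fun_scale)
    have total: "(\<Sum>x\<in>X. l x (T v x)) + (\<Sum>q\<in>P. L q (dual_alg (fst q) (T v (snd q)))) = (\<Sum>b\<in>B. \<nu> b (v b))" for v
    proof -
      have "L q (dual_alg (fst q) (T v (snd q))) = (\<Sum>b\<in>B. rep b (snd q) * m q (v b))" if "q \<in> P" for q
        using dual_T[OF m[OF that], of v "snd q"] by (simp add: m_def bidual_dual_def)
      then have "(\<Sum>x\<in>X. l x (T v x)) + (\<Sum>q\<in>P. L q (dual_alg (fst q) (T v (snd q)))) =
          (\<Sum>x\<in>X. \<Sum>b\<in>B. rep b x * l x (v b)) + (\<Sum>q\<in>P. \<Sum>b\<in>B. rep b (snd q) * m q (v b))"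
        by (simp add: dual_T l)
      also have "\<dots> = (\<Sum>b\<in>B. \<nu> b (v b))"
        by (subst (1 2) sum.swap) (simp add: \<nu>_def sum_fun_apply fun_scale_apply sum.distrib)
      finally show ?thesis .
    qed
    have \<nu>_A: "(\<Sum>b\<in>B. \<nu> b (v b)) = 0" if "v \<in> A" for v
    proof -
      have "R v \<in> U" unfolding U_def using that by blast
      from \<phi>_U[OF this] show ?thesis
        unfolding R_def using \<phi>_sum[of "\<lambda>q. dual_alg (fst q) (T v (snd q))" "T v"] total[of v] PD(1) dual_alg_dual(1)
        by simp
    qed
    \<comment> \<open>On the range of \<open>\<kappa>\<close> this is evaluation. Elsewhere
      \<open>\<nu> b\<close> turns out to be a combination of \<open>F\<close>, and on
      \<open>F\<close> the vector \<open>\<alpha> b\<close> and the functional \<open>b\<close>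
      agree.\<close>
    have \<nu>_\<alpha>: "b (\<nu> b) = \<nu> b (\<alpha> b)" if b: "b \<in> B" for b
    proof (cases "b \<in> range \<kappa>")
      case True
      show ?thesis using \<alpha>_range[OF True] canonical_embedding_apply[OF \<nu>[of b], of "\<alpha> b"] by (simp add: \<kappa>_def)
    next
      case False
      \<comment> \<open>The tuple with entry \<open>a\<close> at \<open>b\<close> and zero elsewhere
        solves the homogeneous conditions, as \<open>b\<close> lies outside the range of
        \<open>\<kappa>\<close>.\<close>
      have "\<nu> b a = 0" if a: "\<And>f. f \<in> F \<Longrightarrow> f a = 0" for a
      proof -
        have "f 0 = 0" if "f \<in> F" for f using that F(3) dual_zero by blast
        then have "(\<lambda>c. if c = b then a else 0) \<in> A" using a False by (intro AI) auto
        from \<nu>_A[OF this] show ?thesis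
          using b B(1) dual_zero[OF \<nu>] by (simp add: if_distrib[of "\<nu> _"] cong: if_cong)
      qed
      then have exp: "\<nu> b a = (\<Sum>f\<in>F. \<nu> b (e f) * f a)" for a
        using F e by (intro dual_system_expansion[OF vector_space_axioms subspace_UNIV]) (auto intro: dual_linear \<nu>)
      have "\<nu> b = (\<Sum>f\<in>F. fun_scale (\<nu> b (e f)) f)"
        by (rule ext) (unfold sum_fun_apply fun_scale_apply, rule exp)
      then have "b (\<nu> b) = b (\<Sum>f\<in>F. fun_scale (\<nu> b (e f)) f)" by simp
      also have "\<dots> = (\<Sum>f\<in>F. \<nu> b (e f) * b f)"
        using b B(3) F(3) by (intro bidual_sum) auto
      also have "\<dots> = \<nu> b (\<alpha> b)"
        using False by (simp add: \<alpha>_def dual_sum[OF \<nu>] dual_scale[OF \<nu>] mult.commute)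
      finally show ?thesis .
    qed
    \<comment> \<open>The two sides are the first and the second Arens product of
      \<open>snd q\<close> and \<open>L q\<close>, evaluated at \<open>fst q\<close>.\<close>
    have reg_q: "snd q (m q) = L q (dual_bidual (fst q) (snd q))" if q: "q \<in> P" for q
    proof -
      have "arens_box smul (snd q) (L q) = arens_diamond smul (snd q) (L q)"
        using reg L[OF q] PD(2)[OF q] unfolding arens_regular_def by blast
      from fun_cong[OF this, of "fst q"] show ?thesis
        using PD(1)[OF q] by (simp add: arens_box_def arens_diamond_def m_def)
    qed
    \<comment> \<open>The computation of \<open>total\<close> repeated for the inclusion of the span
      into the bidual: the \<open>b\<close>-th coordinate of the operator is replaced by
      \<open>b\<close> itself.\<close>
    have trace: "(\<Sum>b\<in>B. b (\<nu> b)) = (\<Sum>x\<in>X. x (l x)) + (\<Sum>q\<in>P. snd q (m q))"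
    proof -
      have "b (\<nu> b) = (\<Sum>x\<in>X. rep b x * b (l x)) + (\<Sum>q\<in>P. rep b (snd q) * b (m q))" if "b \<in> B" for b
      proof -
        have b: "b \<in> bidual smul" using that B(3) by blast
        show ?thesis
          unfolding \<nu>_def using l m
          by (subst bidual_add[OF b]) (auto intro!: fs.subspace_sum[OF subspace_dual] dual_fun_scale simp: bidual_sum[OF b])
      qed
      then have "(\<Sum>b\<in>B. b (\<nu> b)) =
          (\<Sum>b\<in>B. (\<Sum>x\<in>X. rep b x * b (l x)) + (\<Sum>q\<in>P. rep b (snd q) * b (m q)))"
        by (rule sum.cong[OF refl])
      also have "\<dots> = (\<Sum>b\<in>B. \<Sum>x\<in>X. rep b x * b (l x)) + (\<Sum>b\<in>B. \<Sum>q\<in>P. rep b (snd q) * b (m q))"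
        by (rule sum.distrib)
      also have "\<dots> = (\<Sum>x\<in>X. \<Sum>b\<in>B. rep b x * b (l x)) + (\<Sum>q\<in>P. \<Sum>b\<in>B. rep b (snd q) * b (m q))"
        by (simp only: sum.swap[of _ B])
      also have "\<dots> = (\<Sum>x\<in>X. x (l x)) + (\<Sum>q\<in>P. snd q (m q))"
        using XD(2) PD(3) by (simp add: rep_eval[symmetric])
      finally show ?thesis .
    qed
    have "(\<Sum>i\<in>I. \<phi> i (D i)) = (\<Sum>x\<in>X. l x (T \<alpha> x)) +
        (\<Sum>q\<in>P. L q (dual_alg (fst q) (T \<alpha> (snd q)) - dual_bidual (fst q) (snd q)))"
      unfolding D_def using PD by (intro \<phi>_sum dual_minus dual_alg_dual dual_bidual_dual)
    also have "\<dots> = (\<Sum>b\<in>B. \<nu> b (\<alpha> b)) - (\<Sum>q\<in>P. L q (dual_bidual (fst q) (snd q)))"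
      unfolding total[symmetric] using PD L
      by (simp add: bidual_diff dual_alg_dual dual_bidual_dual sum_subtractf)
    \<comment> \<open>Replacing each \<open>\<nu> b (\<alpha> b)\<close> by
      \<open>b (\<nu> b)\<close> and using \<open>reg_q\<close>, the terms indexed by
      \<open>P\<close> cancel.\<close>
    also have "\<dots> = (\<Sum>x\<in>X. x (l x))"
      using trace by (simp add: \<nu>_\<alpha> reg_q)
    finally have "1 \<le> norm (\<Sum>x\<in>X. x (l x))" using \<phi>_D by simp
    also have "\<dots> \<le> (\<Sum>x\<in>X. bidual_norm smul x * onorm (l x))"
      using bidual_norm_bound[OF XD(1) l] by (intro sum_norm_le)
    finally have one_le: "1 \<le> (\<Sum>x\<in>X. bidual_norm smul x * onorm (l x))" .
    \<comment> \<open>Scaling the near-norming vectors to the full radius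
      \<open>bidual_norm smul x + \<eta>\<close> gives a tuple in the product of balls, hence a
      weighted sum of the \<open>v x\<close> that is at most \<open>1\<close>. With the smaller
      weights \<open>bidual_norm smul x + \<eta> / 2\<close> the sum is still at least
      \<open>1\<close>. The gap between the weights forces every \<open>v x\<close> to be zero,
      which is absurd.\<close>
    have "\<forall>x\<in>X. \<exists>a v. norm a \<le> 1 \<and> 0 \<le> v \<and> l x a = of_real v \<and>
        bidual_norm smul x * onorm (l x) \<le> (bidual_norm smul x + \<eta> / 2) * v"
      using ex_near_norming[OF l bidual_norm_nonneg[OF XD(1)]] \<eta> by simp
    then obtain a v where av: "\<And>x. x \<in> X \<Longrightarrow> norm (a x) \<le> 1" "\<And>x. x \<in> X \<Longrightarrow> 0 \<le> v x"
      "\<And>x. x \<in> X \<Longrightarrow> l x (a x) = of_real (v x)"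
      "\<And>x. x \<in> X \<Longrightarrow> bidual_norm smul x * onorm (l x) \<le> (bidual_norm smul x + \<eta> / 2) * v x"
      by metis
    define c where "c x = bidual_norm smul x + \<eta>" for x
    have c: "c x \<ge> 0" if "x \<in> X" for x
      using bidual_norm_nonneg[OF XD(1)[OF that]] \<eta> by (simp add: c_def)
    let ?z = "\<lambda>i. case i of Inl x \<Rightarrow> (smul (of_real (c x)) (a x), 0 :: 'a \<Rightarrow> 'k) | Inr q \<Rightarrow> (0, 0)"
    have "norm (\<Sum>i\<in>I. \<phi> i (?z i)) \<le> 1"
    proof (rule \<phi>_ball)
      fix i assume i: "i \<in> I"
      show "?z i \<in> W \<and> n (?z i) \<le> r i"
      proof (cases i)
        case (Inl x)
        then have x: "x \<in> X" using i by (auto simp: I_def)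
        have "c x * norm (a x) \<le> c x * 1" using c[OF x] av(1)[OF x] by (intro mult_left_mono) auto
        then show ?thesis
          using Inl dual0 c[OF x] by (simp add: W_def n_def r_def norm_smul onorm0 flip: c_def)
      next
        case (Inr q)
        then show ?thesis using dual0 \<eta> by (simp add: W_def n_def r_def onorm0)
      qed
    qed
    also have "(\<Sum>i\<in>I. \<phi> i (?z i)) = (\<Sum>x\<in>X. l x (smul (of_real (c x)) (a x))) + (\<Sum>q\<in>P. L q 0)"
      by (rule \<phi>_sum) (rule dual0)
    also have "\<dots> = (\<Sum>x\<in>X. of_real (c x * v x))"
      using bidual_scale[OF L dual0, of _ 0] by (simp add: dual_scale[OF l] av(3) fs.scale_zero_left)
    finally have "norm (of_real (\<Sum>x\<in>X. c x * v x) :: 'k) \<le> 1" by (simp only: of_real_sum)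
    then have "(\<Sum>x\<in>X. c x * v x) \<le> 1" unfolding norm_of_real by simp
    moreover have "1 \<le> (\<Sum>x\<in>X. (bidual_norm smul x + \<eta> / 2) * v x)"
      by (rule order.trans[OF one_le sum_mono[OF av(4)]])
    moreover have "(\<Sum>x\<in>X. (bidual_norm smul x + \<eta> / 2) * v x) = (\<Sum>x\<in>X. c x * v x) - \<eta> / 2 * (\<Sum>x\<in>X. v x)"
      unfolding c_def sum_distrib_left sum_subtractf[symmetric]
      by (intro sum.cong refl) (simp add: algebra_simps)
    ultimately have "\<eta> / 2 * (\<Sum>x\<in>X. v x) \<le> 0" by simp
    then have "(\<Sum>x\<in>X. v x) \<le> 0" using \<eta> by (simp add: mult_le_0_iff)
    then have "v x = 0" if "x \<in> X" for x
      using that av(2) X(1) sum_nonneg_eq_0_iff[of X v] sum_nonneg[of X v] by force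
    then have "(\<Sum>x\<in>X. (bidual_norm smul x + \<eta> / 2) * v x) = 0" by simp
    then show False using \<open>1 \<le> (\<Sum>x\<in>X. (bidual_norm smul x + \<eta> / 2) * v x)\<close> by simp
  qed
  then obtain v where v: "v \<in> A" and vI: "\<And>i. i \<in> I \<Longrightarrow> n (D i + R v i) < r i" by blast
  let ?T = "T (\<lambda>b. \<alpha> b + v b)"
  show ?thesis
  proof (intro exI[of _ ?T] conjI ballI allI impI)
    show "linear_map_on fun_scale smul (fs.span B) ?T" by (rule T_linear)
  next
    fix \<Phi> \<mu> assume \<Phi>: "\<Phi> \<in> fs.span B" and \<mu>: "\<mu> \<in> fs.span F"
    have \<mu>d: "\<mu> \<in> dual smul" using \<mu> spanF by blast
    have F_eq: "\<Phi> f = f (?T \<Phi>)" if "f \<in> F" for f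
    proof -
      have f: "f \<in> dual smul" using that F(3) by blast
      show ?thesis
        using that by (simp add: dual_T[OF f] rep_eval[OF \<Phi>] dual_add[OF f] \<alpha>_F A_F[OF v])
    qed
    have \<mu>_eq: "\<mu> = (\<Sum>f\<in>F. fun_scale (fs.representation F \<mu> f) f)"
      using fs.sum_representation_eq[OF F(2) \<mu> F(1) order.refl] by simp
    have "\<Phi> \<mu> = (\<Sum>f\<in>F. fs.representation F \<mu> f * \<Phi> f)"
      using \<Phi> spanB F(3) by (subst \<mu>_eq, intro bidual_sum) auto
    also have "\<dots> = \<mu> (?T \<Phi>)"
      by (subst (2) \<mu>_eq) (simp add: sum_fun_apply fun_scale_apply F_eq)
    finally show "\<Phi> \<mu> = \<mu> (?T \<Phi>)" .
  next
    fix a assume a: "\<kappa> a \<in> fs.span B"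
    have inj: "inj \<kappa>" unfolding \<kappa>_def by (rule inj_canonical_embedding)
    let ?C = "B \<inter> range \<kappa>"
    \<comment> \<open>Only basis elements in the range of \<open>\<kappa>\<close> are involved, and
      there \<open>v\<close> vanishes and \<open>\<alpha>\<close> inverts
      \<open>\<kappa>\<close>.\<close>
    obtain c where c: "\<kappa> a = (\<Sum>b\<in>?C. fun_scale (c b) b)"
      using B\<kappa>[rule_format, OF a] fs.span_finite[of ?C] B(1) by auto
    also have "\<dots> = (\<Sum>b\<in>?C. fun_scale (c b) (\<kappa> (\<alpha> b)))" using \<alpha>_range by (intro sum.cong) auto
    also have "\<dots> = \<kappa> (\<Sum>b\<in>?C. smul (c b) (\<alpha> b))"
      unfolding \<kappa>_def by (rule canonical_embedding_sum[symmetric])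
    finally have a_eq: "a = (\<Sum>b\<in>?C. smul (c b) (\<alpha> b))" using inj by (simp add: inj_eq)
    have "?T (\<kappa> a) = (\<Sum>b\<in>?C. smul (c b) (?T b))"
      unfolding c by (intro linear_map_on_sum[OF vector_space_fun_scale vector_space_axioms fs.subspace_span T_linear])
        (auto intro: fs.span_base)
    also have "\<dots> = (\<Sum>b\<in>?C. smul (c b) (\<alpha> b))"
      using A0[OF v] by (intro sum.cong) (auto simp: T_basis)
    finally show "?T (\<kappa> a) = a" using a_eq by simp
  next
    fix x assume "x \<in> X"
    then show "norm (?T x) < bidual_norm smul x + \<eta>"
      using vI[of "Inl x"] by (simp add: I_def InlI n_def D_def R_def r_def T_add onorm0)
  next
    fix q' assume "q' \<in> P"
    then obtain \<mu> \<Phi> where q': "q' = (\<mu>, \<Phi>)" and q: "(\<mu>, \<Phi>) \<in> P" by (cases q') auto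
    have "dual_alg \<mu> (?T \<Phi>) - dual_bidual \<mu> \<Phi> = dual_alg \<mu> (T \<alpha> \<Phi>) - dual_bidual \<mu> \<Phi> + dual_alg \<mu> (T v \<Phi>)"
      using PD(1)[OF q] by (simp add: T_add dual_alg_linear)
    moreover have "onorm (dual_alg \<mu> (T \<alpha> \<Phi>) - dual_bidual \<mu> \<Phi> + dual_alg \<mu> (T v \<Phi>)) < \<eta>"
      using vI[of "Inr (\<mu>, \<Phi>)"] q by (simp add: I_def InrI n_def D_def R_def r_def)
    ultimately have "onorm (dual_alg \<mu> (?T \<Phi>) - dual_bidual \<mu> \<Phi>) < \<eta>" by (simp only:)
    then show "case q' of (\<mu>, \<Phi>) \<Rightarrow> onorm (dual_alg \<mu> (?T \<Phi>) - dual_bidual \<mu> \<Phi>) < \<eta>" by (simp add: q')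
  qed
qed

end

section \<open>Local reflexivity respecting products\<close>

lemma linear_map_on_span_image:
  assumes vs: "vector_space s" "vector_space t" and B: "finite B"
    and T: "linear_map_on s t (module.span s B) T" and x: "x \<in> module.span s B"
  shows "T x \<in> module.span t (T ` B)"
proof -
  interpret s: vector_space s by fact
  interpret t: vector_space t by fact
  obtain c where "x = (\<Sum>b\<in>B. s (c b) b)" using x s.span_finite[OF B] by auto
  then have "T x = (\<Sum>b\<in>B. t (c b) (T b))"
    using linear_map_on_sum[OF vs s.subspace_span T, of B "\<lambda>b. b" c] s.span_base by simp
  then show ?thesis by (simp only:) (intro t.span_sum t.span_scale t.span_base imageI)
qed

text \<open>Products of basis elements span all products. This keeps the spans of the Arens products
  and of both module actions on the dual finite-dimensional.\<close>

lemma bilinear_span_image: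
  assumes vs: "vector_space s" "vector_space s'" "vector_space t" and fin: "finite B" "finite B'"
    and left: "\<And>y. y \<in> module.span s' B' \<Longrightarrow> linear_map_on s t (module.span s B) (\<lambda>x. \<beta> x y)"
    and right: "\<And>x. x \<in> module.span s B \<Longrightarrow> linear_map_on s' t (module.span s' B') (\<beta> x)"
    and x: "x \<in> module.span s B" and y: "y \<in> module.span s' B'"
  shows "\<beta> x y \<in> module.span t ((\<lambda>(b, b'). \<beta> b b') ` (B \<times> B'))"
proof -
  interpret s: vector_space s by fact
  interpret s': vector_space s' by fact
  interpret t: vector_space t by fact
  have "\<beta> b y \<in> t.span ((\<lambda>(b, b'). \<beta> b b') ` (B \<times> B'))" if b: "b \<in> B" for b
  proof -
    have "\<beta> b y \<in> t.span (\<beta> b ` B')"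
      using b by (intro linear_map_on_span_image[OF vs(2,3) fin(2) right y] s.span_base)
    moreover have "t.span (\<beta> b ` B') \<subseteq> t.span ((\<lambda>(b, b'). \<beta> b b') ` (B \<times> B'))"
      using b by (intro t.span_mono) auto
    ultimately show ?thesis by blast
  qed
  then have "t.span ((\<lambda>x. \<beta> x y) ` B) \<subseteq> t.span ((\<lambda>(b, b'). \<beta> b b') ` (B \<times> B'))"
    by (intro t.span_minimal t.subspace_span) auto
  then show ?thesis using linear_map_on_span_image[OF vs(1,3) fin(1) left[OF y] x] by blast
qed

lemma fin_dim_subspace_basis:
  assumes "fin_dim_subspace fun_scale V"
  obtains B where "finite B" "fs.independent B" "V = fs.span B"
proof -
  obtain C where C: "finite C" "V = fs.span C" using assms unfolding fin_dim_subspace_def by blast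
  obtain B where B: "B \<subseteq> V" "fs.independent B" "V \<subseteq> fs.span B"
    using fs.maximal_independent_subset[of V] by blast
  have "finite B" using fs.independent_span_bound[OF C(1) B(2)] B(1) C(2) by blast
  moreover have "V = fs.span B"
    using B fs.span_minimal[of B V] C(2) fs.subspace_span by blast
  ultimately show thesis using that B(2) by blast
qed

context banach_algebra_over
begin

section \<open>Uniform estimates on finite-dimensional subspaces\<close>

lemma bidual_norm_scale:
  assumes "\<Phi> \<in> bidual smul"
  shows "bidual_norm smul (fun_scale c \<Phi>) = norm c * bidual_norm smul \<Phi>"
proof (cases "c = 0")
  case True
  then show ?thesis
    using bidual_norm_scale_le[OF assms, of c] bidual_norm_nonneg[OF fs.subspace_scale[OF subspace_bidual assms, of c]] by simp
next
  case False
  have "bidual_norm smul (fun_scale (inverse c) (fun_scale c \<Phi>)) \<le> norm (inverse c) * bidual_norm smul (fun_scale c \<Phi>)"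
    by (intro bidual_norm_scale_le fs.subspace_scale[OF subspace_bidual] assms)
  then have "norm c * bidual_norm smul \<Phi> \<le> bidual_norm smul (fun_scale c \<Phi>)"
    using False by (simp add: fs.scale_scale norm_divide norm_inverse divide_simps mult.commute)
  then show ?thesis using bidual_norm_scale_le[OF assms, of c] by simp
qed

lemma bidual_norm_eq_0D:
  assumes "\<Phi> \<in> bidual smul" "bidual_norm smul \<Phi> = 0"
  shows "\<Phi> = 0"
proof
  fix \<mu> show "\<Phi> \<mu> = 0 \<mu>"
    using bidual_norm_bound[OF assms(1), of \<mu>] bidual_outside[OF assms(1), of \<mu>] assms(2)
    by (cases "\<mu> \<in> dual smul") auto
qed

text \<open>Otherwise \<open>bidual_norm smul \<Phi> - \<eta>\<close> would bound the set whose
  supremum is the norm. The statement ranges over all functions, so a choice function can be drawn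
  without side condition.\<close>

lemma ex_bidual_norming:
  assumes "0 < \<eta>"
  shows "\<exists>\<mu>\<in>dual smul. onorm \<mu> \<le> 1 \<and> bidual_norm smul \<Phi> - \<eta> \<le> norm (\<Phi> \<mu>)"
proof (rule ccontr)
  assume "\<not> ?thesis"
  then have *: "norm (\<Phi> \<mu>) \<le> bidual_norm smul \<Phi> - \<eta>" if "\<mu> \<in> dual smul" "onorm \<mu> \<le> 1" for \<mu>
    using that by force
  have "0 \<in> dual smul" using fs.subspace_0[OF subspace_dual] .
  moreover have "onorm (0 :: 'a \<Rightarrow> 'k) = 0" by (simp add: zero_fun_def onorm_zero)
  ultimately have "bidual_norm smul \<Phi> \<le> bidual_norm smul \<Phi> - \<eta>"
    by (subst bidual_norm_def, intro cSUP_least) (force, use * in auto)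
  then show False using assms by simp
qed

text \<open>The coordinate of \<open>\<Phi>\<close> at \<open>b\<close> is the value of
  \<open>\<Phi>\<close> at a functional biorthogonal to the basis, so the norms of these functionals
  bound the coordinates.\<close>

lemma ex_bidual_coordinate_bound:
  assumes B: "finite B" "fs.independent B" "B \<subseteq> bidual smul"
  shows "\<exists>C\<ge>0. \<forall>\<Phi>\<in>fs.span B. \<forall>b\<in>B. norm (fs.representation B \<Phi> b) \<le> C * bidual_norm smul \<Phi>"
proof -
  have spanB: "fs.span B \<subseteq> bidual smul" using fs.span_minimal[OF B(3) subspace_bidual] .
  have "\<exists>e. (\<forall>f\<in>B. e f \<in> dual smul) \<and> (\<forall>f\<in>B. \<forall>g\<in>B. f (e g) = (if f = g then 1 else 0))"
    using B bidual_linear bidual_outside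
    by (intro ex_dual_system[OF vector_space_fun_scale subspace_dual]) (auto simp: subset_eq)
  then obtain e where e: "\<forall>f\<in>B. e f \<in> dual smul" "\<forall>f\<in>B. \<forall>g\<in>B. f (e g) = (if f = g then 1 else 0)"
    by (elim exE conjE)
  define C where "C = (\<Sum>b\<in>B. onorm (e b))"
  have pos: "0 \<le> onorm (e b)" if "b \<in> B" for b using that e(1) onorm_dual_nonneg by blast
  have "norm (fs.representation B \<Phi> b) \<le> C * bidual_norm smul \<Phi>" if \<Phi>: "\<Phi> \<in> fs.span B" and b: "b \<in> B" for \<Phi> b
  proof -
    have \<Phi>b: "\<Phi> \<in> bidual smul" using \<Phi> spanB by blast
    have "\<Phi> (e b) = (\<Sum>c\<in>B. fs.representation B \<Phi> c * c (e b))"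
      using fun_cong[OF fs.sum_representation_eq[OF B(2) \<Phi> B(1) order.refl], of "e b"]
      by (simp add: sum_fun_apply fun_scale_apply)
    also have "\<dots> = (\<Sum>c\<in>B. fs.representation B \<Phi> c * (if c = b then 1 else 0))"
      using e(2) b by (intro sum.cong) auto
    also have "\<dots> = fs.representation B \<Phi> b"
      using b B(1) by (simp add: if_distrib[of "\<lambda>c. _ * c"] cong: if_cong)
    finally have "norm (fs.representation B \<Phi> b) \<le> bidual_norm smul \<Phi> * onorm (e b)"
      using bidual_norm_bound[OF \<Phi>b, of "e b"] e(1) b by simp
    also have "\<dots> \<le> bidual_norm smul \<Phi> * C"
      unfolding C_def using b B(1) pos
      by (intro mult_left_mono member_le_sum bidual_norm_nonneg[OF \<Phi>b]) auto
    finally show ?thesis by (simp add: mult.commute)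
  qed
  moreover have "0 \<le> C" unfolding C_def using pos by (rule sum_nonneg)
  ultimately show ?thesis by blast
qed

text \<open>The same device one level lower: coordinates are values at vectors of the algebra
  biorthogonal to \<open>F\<close>.\<close>

lemma ex_dual_coordinate_bound:
  assumes F: "finite F" "fs.independent F" "F \<subseteq> dual smul"
  shows "\<exists>C\<ge>0. \<forall>\<mu>\<in>fs.span F. \<forall>f\<in>F. norm (fs.representation F \<mu> f) \<le> C * onorm \<mu>"
proof -
  have spanF: "fs.span F \<subseteq> dual smul" using fs.span_minimal[OF F(3) subspace_dual] .
  have "\<exists>e. (\<forall>f\<in>F. e f \<in> UNIV) \<and> (\<forall>f\<in>F. \<forall>g\<in>F. f (e g) = (if f = g then 1 else 0))"
    using F dual_linear by (intro ex_dual_system[OF vector_space_axioms subspace_UNIV]) auto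
  then obtain e where e: "\<forall>f\<in>F. \<forall>g\<in>F. f (e g) = (if f = g then 1 else 0)"
    by (elim exE conjE)
  define C where "C = (\<Sum>f\<in>F. norm (e f))"
  have "norm (fs.representation F \<mu> f) \<le> C * onorm \<mu>" if \<mu>: "\<mu> \<in> fs.span F" and f: "f \<in> F" for \<mu> f
  proof -
    have \<mu>d: "\<mu> \<in> dual smul" using \<mu> spanF by blast
    have "\<mu> (e f) = (\<Sum>c\<in>F. fs.representation F \<mu> c * c (e f))"
      using fun_cong[OF fs.sum_representation_eq[OF F(2) \<mu> F(1) order.refl], of "e f"]
      by (simp add: sum_fun_apply fun_scale_apply)
    also have "\<dots> = (\<Sum>c\<in>F. fs.representation F \<mu> c * (if c = f then 1 else 0))"
      using e f by (intro sum.cong) auto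
    also have "\<dots> = fs.representation F \<mu> f"
      using f F(1) by (simp add: if_distrib[of "\<lambda>c. _ * c"] cong: if_cong)
    finally have "norm (fs.representation F \<mu> f) \<le> onorm \<mu> * norm (e f)"
      using dual_norm_le[OF \<mu>d, of "e f"] by simp
    also have "\<dots> \<le> onorm \<mu> * C"
      unfolding C_def using f F(1) by (intro mult_left_mono member_le_sum onorm_dual_nonneg[OF \<mu>d]) auto
    finally show ?thesis by (simp add: mult.commute)
  qed
  moreover have "0 \<le> C" unfolding C_def by (simp add: sum_nonneg)
  ultimately show ?thesis by blast
qed

text \<open>The net must serve every \<open>T\<close> at once, because it is chosen before
  \<open>T\<close>. Its points approximate coordinates, and the bounds of \<open>T\<close> on the
  basis turn this into an approximation of \<open>T \<Phi>\<close> as well.\<close>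

lemma ex_finite_net:
  assumes B: "finite B" "fs.independent B" "B \<subseteq> bidual smul" and \<delta>: "0 < \<delta>"
  shows "\<exists>X. finite X \<and> X \<subseteq> fs.span B \<and>
    (\<forall>T. linear_map_on fun_scale smul (fs.span B) T \<longrightarrow> (\<forall>x\<in>X. norm (T x) \<le> bidual_norm smul x + 1) \<longrightarrow>
      (\<forall>\<Phi>\<in>fs.span B. bidual_norm smul \<Phi> \<le> 1 \<longrightarrow>
        (\<exists>x\<in>X. bidual_norm smul (\<Phi> - x) \<le> \<delta> \<and> norm (T \<Phi> - T x) \<le> \<delta>)))"
proof -
  obtain C where C: "0 \<le> C" "\<And>\<Phi> b. \<Phi> \<in> fs.span B \<Longrightarrow> b \<in> B \<Longrightarrow> norm (fs.representation B \<Phi> b) \<le> C * bidual_norm smul \<Phi>"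
    using ex_bidual_coordinate_bound[OF B] by blast
  define S where "S = (\<Sum>b\<in>B. bidual_norm smul b + 1)"
  have b_pos: "0 \<le> bidual_norm smul b" if "b \<in> B" for b using that B(3) bidual_norm_nonneg by blast
  have S: "0 \<le> S" unfolding S_def using b_pos by (intro sum_nonneg) (auto intro: add_nonneg_nonneg)
  \<comment> \<open>Coordinate errors below \<open>d\<close> cost at most \<open>d * S\<close> in
    norm, both before and after applying \<open>T\<close>; the added \<open>1\<close> covers
    \<open>S = 0\<close>.\<close>
  define d where "d = \<delta> / (S + 1)"
  have d: "0 < d" "d * S \<le> \<delta>" using \<delta> S by (auto simp: d_def field_simps)
  obtain G :: "'k set" where G: "finite G" "\<And>x. norm x \<le> C \<Longrightarrow> \<exists>g\<in>G. norm (x - g) < d"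
    using finite_scalar_net[OF d(1)] by blast
  \<comment> \<open>The basis is included so that the assumption on \<open>X\<close> bounds
    \<open>norm (T b)\<close> by the summand \<open>bidual_norm smul b + 1\<close> of
    \<open>S\<close>.\<close>
  define X where "X = B \<union> (\<lambda>g. \<Sum>b\<in>B. fun_scale (g b) b) ` (B \<rightarrow>\<^sub>E G)"
  show ?thesis
  proof (intro exI[of _ X] conjI allI impI ballI)
    show "finite X" unfolding X_def using B(1) G(1) by (simp add: finite_PiE)
    show "X \<subseteq> fs.span B"
      unfolding X_def using fs.span_base[of _ B] by (auto intro!: fs.span_sum[of B] fs.span_scale)
    fix T \<Phi> assume T: "linear_map_on fun_scale smul (fs.span B) T"
      and T_le: "\<forall>x\<in>X. norm (T x) \<le> bidual_norm smul x + 1"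
      and \<Phi>: "\<Phi> \<in> fs.span B" "bidual_norm smul \<Phi> \<le> 1"
    let ?r = "fs.representation B \<Phi>"
    have "\<exists>g\<in>G. norm (?r b - g) < d" if "b \<in> B" for b
      using C(2)[OF \<Phi>(1) that] mult_left_mono[OF \<Phi>(2) C(1)] by (intro G(2)) simp
    then obtain g where g: "\<And>b. b \<in> B \<Longrightarrow> g b \<in> G \<and> norm (?r b - g b) < d" by metis
    define x where "x = (\<Sum>b\<in>B. fun_scale (restrict g B b) b)"
    have xX: "x \<in> X" unfolding X_def x_def using g by (intro UnI2 imageI) auto
    have diff: "\<Phi> - x = (\<Sum>b\<in>B. fun_scale (?r b - g b) b)"
      using fs.sum_representation_eq[OF B(2) \<Phi>(1) B(1) order.refl]
      by (simp add: x_def fs.scale_left_diff_distrib sum_subtractf)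
    have "bidual_norm smul (\<Phi> - x) \<le> (\<Sum>b\<in>B. bidual_norm smul (fun_scale (?r b - g b) b))"
      unfolding diff using B(3) by (intro bidual_norm_sum_le fs.subspace_scale[OF subspace_bidual]) auto
    also have "\<dots> \<le> (\<Sum>b\<in>B. d * (bidual_norm smul b + 1))"
    proof (rule sum_mono)
      fix b assume b: "b \<in> B"
      have "norm (?r b - g b) * bidual_norm smul b \<le> d * (bidual_norm smul b + 1)"
        using g[OF b] b_pos[OF b] d by (intro mult_mono) auto
      then show "bidual_norm smul (fun_scale (?r b - g b) b) \<le> d * (bidual_norm smul b + 1)"
        using b B(3) bidual_norm_scale[of b] by auto
    qed
    also have "\<dots> \<le> \<delta>" using d(2) by (simp add: S_def sum_distrib_left)
    finally have 1: "bidual_norm smul (\<Phi> - x) \<le> \<delta>" .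
    have xB: "x \<in> fs.span B" unfolding x_def by (intro fs.span_sum fs.span_scale fs.span_base)
    have "T \<Phi> - T x = T (\<Phi> - x)"
      using linear_map_on_diff[OF vector_space_fun_scale vector_space_axioms fs.subspace_span T \<Phi>(1) xB] by simp
    also have "\<dots> = (\<Sum>b\<in>B. smul (?r b - g b) (T b))"
      unfolding diff
      by (rule linear_map_on_sum[OF vector_space_fun_scale vector_space_axioms fs.subspace_span T]) (rule fs.span_base)
    also have "norm \<dots> \<le> (\<Sum>b\<in>B. d * (bidual_norm smul b + 1))"
    proof (rule sum_norm_le)
      fix b assume b: "b \<in> B"
      have "norm (T b) \<le> bidual_norm smul b + 1" using b by (intro T_le[rule_format]) (simp add: X_def)
      then have "norm (?r b - g b) * norm (T b) \<le> d * (bidual_norm smul b + 1)"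
        using g[OF b] b_pos[OF b] d by (intro mult_mono) auto
      then show "norm (smul (?r b - g b) (T b)) \<le> d * (bidual_norm smul b + 1)" by (simp add: norm_smul)
    qed
    also have "\<dots> \<le> \<delta>" using d(2) by (simp add: S_def sum_distrib_left)
    finally show "\<exists>x\<in>X. bidual_norm smul (\<Phi> - x) \<le> \<delta> \<and> norm (T \<Phi> - T x) \<le> \<delta>" using 1 xX by blast
  qed
qed

text \<open>The lower estimate comes for free from exact interpolation on enough functionals.\<close>

lemma ex_eps_isomorphism_test:
  assumes B: "finite B" "fs.independent B" "B \<subseteq> bidual smul" and \<epsilon>: "0 < \<epsilon>"
  shows "\<exists>X Y. \<exists>\<eta>>0. finite X \<and> X \<subseteq> fs.span B \<and> finite Y \<and> Y \<subseteq> dual smul \<and>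
    (\<forall>T. linear_map_on fun_scale smul (fs.span B) T \<longrightarrow> (\<forall>x\<in>X. norm (T x) \<le> bidual_norm smul x + \<eta>) \<longrightarrow>
      (\<forall>\<Phi>\<in>fs.span B. \<forall>\<mu>\<in>Y. \<Phi> \<mu> = \<mu> (T \<Phi>)) \<longrightarrow>
      eps_isomorphism_on \<epsilon> (fs.span B) (bidual_norm smul) norm T)"
proof -
  have spanB: "fs.span B \<subseteq> bidual smul" using fs.span_minimal[OF B(3) subspace_bidual] .
  \<comment> \<open>Each estimate loses \<open>\<eta>\<close> three times: passage from
    \<open>\<Phi>\<close> to \<open>x\<close> and from \<open>T \<Phi>\<close> to \<open>T x\<close>
    and the slack of \<open>T\<close> on \<open>X\<close> for the upper one; passage to
    \<open>x\<close>, near-norming, and return to \<open>\<Phi>\<close> for the lower one. The bound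
    \<open>1\<close> meets the assumption of the net.\<close>
  define \<eta> where "\<eta> = min 1 (\<epsilon> / 3)"
  have \<eta>: "0 < \<eta>" "\<eta> \<le> 1" "\<eta> \<le> \<epsilon> / 3" using \<epsilon> by (auto simp: \<eta>_def)
  obtain X where X: "finite X" "X \<subseteq> fs.span B" and
    net: "\<forall>T. linear_map_on fun_scale smul (fs.span B) T \<longrightarrow> (\<forall>x\<in>X. norm (T x) \<le> bidual_norm smul x + 1) \<longrightarrow>
      (\<forall>\<Phi>\<in>fs.span B. bidual_norm smul \<Phi> \<le> 1 \<longrightarrow>
        (\<exists>x\<in>X. bidual_norm smul (\<Phi> - x) \<le> \<eta> \<and> norm (T \<Phi> - T x) \<le> \<eta>))"
    using ex_finite_net[OF B \<eta>(1)] by (elim exE conjE)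
  obtain y where y: "\<And>x. y x \<in> dual smul" "\<And>x. onorm (y x) \<le> 1"
      "\<And>x. bidual_norm smul x - \<eta> \<le> norm (x (y x))"
    using ex_bidual_norming[OF \<eta>(1)] by metis
  show ?thesis
  proof (intro exI[of _ X] exI[of _ "y ` X"] exI[of _ \<eta>] conjI allI impI)
    show "finite X" "X \<subseteq> fs.span B" "0 < \<eta>" by (fact X \<eta>(1))+
    show "finite (y ` X)" "y ` X \<subseteq> dual smul" using X y by auto
    fix T assume T: "linear_map_on fun_scale smul (fs.span B) T"
      and T_le: "\<forall>x\<in>X. norm (T x) \<le> bidual_norm smul x + \<eta>"
      and T_eq: "\<forall>\<Phi>\<in>fs.span B. \<forall>\<mu>\<in>y ` X. \<Phi> \<mu> = \<mu> (T \<Phi>)"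
    have unit: "1 - \<epsilon> \<le> norm (T \<Phi>) \<and> norm (T \<Phi>) \<le> 1 + \<epsilon>"
      if \<Phi>: "\<Phi> \<in> fs.span B" "bidual_norm smul \<Phi> = 1" for \<Phi>
    proof -
      have T_le1: "\<forall>x\<in>X. norm (T x) \<le> bidual_norm smul x + 1"
        using T_le \<eta>(2) by force
      obtain x where x: "x \<in> X" "bidual_norm smul (\<Phi> - x) \<le> \<eta>" "norm (T \<Phi> - T x) \<le> \<eta>"
        using net[rule_format, OF T T_le1[rule_format] \<Phi>(1)] \<Phi>(2) by auto
      have bd: "\<Phi> \<in> bidual smul" "x \<in> bidual smul" using \<Phi>(1) x(1) X(2) spanB by auto
      have bd': "\<Phi> - x \<in> bidual smul" "x - \<Phi> \<in> bidual smul"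
        using bd fs.subspace_diff[OF subspace_bidual] by auto
      have sym: "bidual_norm smul (x - \<Phi>) = bidual_norm smul (\<Phi> - x)"
        using bidual_norm_scale[OF bd'(1), of "-1"] by (simp add: fs.scale_minus_left)
      have "bidual_norm smul x \<le> 1 + \<eta>"
        using bidual_norm_add_le[OF bd(1) bd'(2)] \<Phi>(2) x(2) by (simp add: sym)
      moreover have "norm (T \<Phi>) \<le> norm (T x) + \<eta>"
        using x(3) norm_triangle_sub[of "T \<Phi>" "T x"] by simp
      ultimately have "norm (T \<Phi>) \<le> 1 + \<epsilon>" using T_le[rule_format, OF x(1)] \<eta>(3) by simp
      have "1 \<le> bidual_norm smul x + \<eta>"
        using bidual_norm_add_le[OF bd(2) bd'(1)] \<Phi>(2) x(2) by simp
      then have "1 - 2 * \<eta> \<le> norm (x (y x))" using y(3)[of x] by simp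
      also have "x (y x) = \<Phi> (y x) - (\<Phi> - x) (y x)" by simp
      also have "norm (\<Phi> (y x) - (\<Phi> - x) (y x)) \<le> norm (\<Phi> (y x)) + norm ((\<Phi> - x) (y x))" by (rule norm_triangle_ineq4)
      also have "norm ((\<Phi> - x) (y x)) \<le> \<eta>"
        using bidual_norm_bound[OF bd'(1) y(1)[of x]] x(2) mult_mono[OF x(2) y(2)[of x]] \<eta>(1)
          onorm_dual_nonneg[OF y(1)[of x]] by simp
      finally have "1 - 3 * \<eta> \<le> norm (\<Phi> (y x))" by simp
      also have "\<Phi> (y x) = y x (T \<Phi>)" using \<Phi>(1) x(1) by (intro T_eq[rule_format]) auto
      also have "norm \<dots> \<le> 1 * norm (T \<Phi>)"
        by (rule order.trans[OF dual_norm_le[OF y(1)] mult_right_mono[OF y(2) norm_ge_zero]])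
      finally show ?thesis using \<open>norm (T \<Phi>) \<le> 1 + \<epsilon>\<close> \<eta>(3) by simp
    qed
    show "eps_isomorphism_on \<epsilon> (fs.span B) (bidual_norm smul) norm T"
      unfolding eps_isomorphism_on_def
    proof
      fix \<Phi> assume \<Phi>: "\<Phi> \<in> fs.span B"
      then have bd: "\<Phi> \<in> bidual smul" using spanB by blast
      have scale: "T (fun_scale c \<Phi>) = smul c (T \<Phi>)" for c
        using T \<Phi> unfolding linear_map_on_def by blast
      define n where "n = bidual_norm smul \<Phi>"
      show "(1 - \<epsilon>) * bidual_norm smul \<Phi> \<le> norm (T \<Phi>) \<and> norm (T \<Phi>) \<le> (1 + \<epsilon>) * bidual_norm smul \<Phi>"
      proof (cases "n = 0")
        case True
        then have "\<Phi> = 0" using bidual_norm_eq_0D[OF bd] by (simp add: n_def)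
        then have "T \<Phi> = 0" using scale[of 0] by (simp add: fs.scale_zero_left)
        then show ?thesis using True by (simp add: n_def)
      next
        case False
        then have n: "0 < n" using bidual_norm_nonneg[OF bd] by (simp add: n_def)
        let ?\<Phi> = "fun_scale (of_real (1 / n)) \<Phi>"
        have "bidual_norm smul ?\<Phi> = 1"
          using n bidual_norm_scale[OF bd, of "of_real (1 / n)"] by (simp add: n_def[symmetric] norm_divide)
        then have "1 - \<epsilon> \<le> norm (T ?\<Phi>) \<and> norm (T ?\<Phi>) \<le> 1 + \<epsilon>"
          using \<Phi> by (intro unit fs.span_scale)
        moreover have "norm (T ?\<Phi>) = norm (T \<Phi>) / n"
          using n by (simp add: scale norm_smul norm_divide)
        ultimately have "1 - \<epsilon> \<le> norm (T \<Phi>) / n \<and> norm (T \<Phi>) / n \<le> 1 + \<epsilon>" by (simp only:)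
        then show ?thesis unfolding n_def[symmetric] using n by (simp add: field_simps)
      qed
    qed
  qed
qed

lemma dual_bidual_linear_left:
  assumes "\<Phi> \<in> bidual smul"
  shows "linear_map_on fun_scale fun_scale (dual smul) (\<lambda>\<mu>. dual_bidual \<mu> \<Phi>)"
proof -
  have add: "alg_dual a (\<mu> + \<nu>) = alg_dual a \<mu> + alg_dual a \<nu>" for a and \<mu> \<nu> :: "'a \<Rightarrow> 'k"
    by (auto simp: alg_dual_def)
  have scale: "alg_dual a (fun_scale c \<mu>) = fun_scale c (alg_dual a \<mu>)" for a c and \<mu> :: "'a \<Rightarrow> 'k"
    by (auto simp: alg_dual_def fun_scale_apply)
  show ?thesis
    unfolding linear_map_on_def using assms
    by (auto simp: dual_bidual_def add scale bidual_add bidual_scale alg_dual_dual fun_scale_apply)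
qed

lemma dual_bidual_linear_right: "linear_map_on fun_scale fun_scale S (dual_bidual \<mu>)"
  unfolding linear_map_on_def by (auto simp: dual_bidual_def fun_scale_apply)

lemma linear_map_on_subset: "linear_map_on s t V T \<Longrightarrow> V' \<subseteq> V \<Longrightarrow> linear_map_on s t V' T"
  unfolding linear_map_on_def by blast

text \<open>The error is bilinear in the functional and the bidual element, so its size at pairs of
  basis elements controls it everywhere. \<open>K\<close> precedes \<open>T\<close> and
  \<open>\<eta>\<close> in the quantifiers, which permits choosing the tolerance in terms of
  \<open>K\<close>.\<close>

lemma ex_module_error_bound:
  assumes B: "finite B" "fs.independent B" "B \<subseteq> bidual smul"
    and F: "finite F" "fs.independent F" "F \<subseteq> dual smul"
  shows "\<exists>K\<ge>0. \<forall>T \<eta>. linear_map_on fun_scale smul (fs.span B) T \<longrightarrow>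
    (\<forall>f\<in>F. \<forall>b\<in>B. onorm (dual_alg f (T b) - dual_bidual f b) \<le> \<eta>) \<longrightarrow>
    (\<forall>\<mu>\<in>fs.span F. \<forall>\<Phi>\<in>fs.span B.
       onorm (dual_alg \<mu> (T \<Phi>) - dual_bidual \<mu> \<Phi>) \<le> K * \<eta> * onorm \<mu> * bidual_norm smul \<Phi>)"
proof -
  have spanB: "fs.span B \<subseteq> bidual smul" using fs.span_minimal[OF B(3) subspace_bidual] .
  have spanF: "fs.span F \<subseteq> dual smul" using fs.span_minimal[OF F(3) subspace_dual] .
  obtain C where C: "0 \<le> C" "\<And>\<Phi> b. \<Phi> \<in> fs.span B \<Longrightarrow> b \<in> B \<Longrightarrow> norm (fs.representation B \<Phi> b) \<le> C * bidual_norm smul \<Phi>"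
    using ex_bidual_coordinate_bound[OF B] by blast
  obtain C' where C': "0 \<le> C'" "\<And>\<mu> f. \<mu> \<in> fs.span F \<Longrightarrow> f \<in> F \<Longrightarrow> norm (fs.representation F \<mu> f) \<le> C' * onorm \<mu>"
    using ex_dual_coordinate_bound[OF F] by blast
  \<comment> \<open>There are \<open>card F * card B\<close> terms, each with coefficients bounded
    through \<open>C'\<close> and \<open>C\<close>.\<close>
  define K where "K = card F * card B * C' * C"
  show ?thesis
  proof (intro exI[of _ K] conjI allI impI ballI)
    show "0 \<le> K" using C(1) C'(1) by (simp add: K_def)
    fix T \<eta> \<mu> \<Phi> assume T: "linear_map_on fun_scale smul (fs.span B) T"
      and err: "\<forall>f\<in>F. \<forall>b\<in>B. onorm (dual_alg f (T b) - dual_bidual f b) \<le> \<eta>"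
      and \<mu>: "\<mu> \<in> fs.span F" and \<Phi>: "\<Phi> \<in> fs.span B"
    define \<Delta> where "\<Delta> \<mu> \<Phi> = dual_alg \<mu> (T \<Phi>) - dual_bidual \<mu> \<Phi>" for \<mu> \<Phi>
    have \<Delta>_dual: "\<Delta> \<mu> \<Phi> \<in> dual smul" if "\<mu> \<in> dual smul" "\<Phi> \<in> bidual smul" for \<mu> \<Phi>
      unfolding \<Delta>_def using that by (intro dual_minus dual_alg_dual dual_bidual_dual)
    have left: "linear_map_on fun_scale fun_scale (dual smul) (\<lambda>\<mu>. \<Delta> \<mu> \<Phi>)" if "\<Phi> \<in> bidual smul" for \<Phi>
      using dual_bidual_linear_left[OF that] unfolding linear_map_on_def \<Delta>_def
      by (auto simp: dual_alg_add_left dual_alg_scale_left fs.scale_right_diff_distrib)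
    have right: "linear_map_on fun_scale fun_scale (fs.span B) (\<Delta> \<mu>)" if "\<mu> \<in> dual smul" for \<mu>
      using dual_bidual_linear_right[of "fs.span B" \<mu>] T that unfolding linear_map_on_def \<Delta>_def
      by (auto simp: dual_alg_linear fs.scale_right_diff_distrib)
    let ?c = "fs.representation F \<mu>" and ?d = "fs.representation B \<Phi>"
    have \<mu>_eq: "(\<Sum>f\<in>F. fun_scale (?c f) f) = \<mu>" by (rule fs.sum_representation_eq[OF F(2) \<mu> F(1) order.refl])
    have \<Phi>_eq: "(\<Sum>b\<in>B. fun_scale (?d b) b) = \<Phi>" by (rule fs.sum_representation_eq[OF B(2) \<Phi> B(1) order.refl])
    have \<Phi>b: "\<Phi> \<in> bidual smul" and \<mu>d: "\<mu> \<in> dual smul" using \<Phi> \<mu> spanB spanF by auto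
    have "\<Delta> \<mu> \<Phi> = (\<Sum>f\<in>F. fun_scale (?c f) (\<Delta> f \<Phi>))"
      using linear_map_on_sum[OF vector_space_fun_scale vector_space_fun_scale subspace_dual left[OF \<Phi>b], of F "\<lambda>f. f" ?c] F(3) \<mu>_eq
      by auto
    also have "\<dots> = (\<Sum>f\<in>F. fun_scale (?c f) (\<Sum>b\<in>B. fun_scale (?d b) (\<Delta> f b)))"
    proof (rule sum.cong[OF refl])
      fix f assume "f \<in> F"
      then have "f \<in> dual smul" using F(3) by blast
      have "\<Delta> f (\<Sum>b\<in>B. fun_scale (?d b) b) = (\<Sum>b\<in>B. fun_scale (?d b) (\<Delta> f b))"
        by (rule linear_map_on_sum[OF vector_space_fun_scale vector_space_fun_scale fs.subspace_span right[OF \<open>f \<in> dual smul\<close>]])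
          (rule fs.span_base)
      then show "fun_scale (?c f) (\<Delta> f \<Phi>) = fun_scale (?c f) (\<Sum>b\<in>B. fun_scale (?d b) (\<Delta> f b))"
        by (simp only: \<Phi>_eq)
    qed
    finally have expand: "\<Delta> \<mu> \<Phi> = (\<Sum>f\<in>F. fun_scale (?c f) (\<Sum>b\<in>B. fun_scale (?d b) (\<Delta> f b)))" .
    have db: "fun_scale (?d b) (\<Delta> f b) \<in> dual smul" if "f \<in> F" "b \<in> B" for f b
      using that F(3) B(3) by (intro dual_fun_scale \<Delta>_dual) auto
    have inner: "onorm (\<Sum>b\<in>B. fun_scale (?d b) (\<Delta> f b)) \<le> card B * (C * bidual_norm smul \<Phi> * \<eta>)" if f: "f \<in> F" for f
    proof -
      have "onorm (\<Sum>b\<in>B. fun_scale (?d b) (\<Delta> f b)) \<le> (\<Sum>b\<in>B. onorm (fun_scale (?d b) (\<Delta> f b)))"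
        using db[OF f] by (intro onorm_sum_le)
      also have "\<dots> \<le> (\<Sum>b\<in>B. C * bidual_norm smul \<Phi> * \<eta>)"
      proof (rule sum_mono)
        fix b assume b: "b \<in> B"
        have fd: "\<Delta> f b \<in> dual smul" using f b F(3) B(3) by (intro \<Delta>_dual) auto
        have "onorm (fun_scale (?d b) (\<Delta> f b)) \<le> norm (?d b) * onorm (\<Delta> f b)" by (rule onorm_fun_scale_le[OF fd])
        also have "\<dots> \<le> C * bidual_norm smul \<Phi> * \<eta>"
          using err[rule_format, OF f b] C(1) bidual_norm_nonneg[OF \<Phi>b] onorm_dual_nonneg[OF fd]
          by (intro mult_mono C(2)[OF \<Phi> b]) (auto simp: \<Delta>_def)
        finally show "onorm (fun_scale (?d b) (\<Delta> f b)) \<le> C * bidual_norm smul \<Phi> * \<eta>" .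
      qed
      finally show ?thesis by simp
    qed
    have sd: "(\<Sum>b\<in>B. fun_scale (?d b) (\<Delta> f b)) \<in> dual smul" if "f \<in> F" for f
      using db[OF that] by (intro fs.subspace_sum[OF subspace_dual])
    have "onorm (\<Delta> \<mu> \<Phi>) \<le> (\<Sum>f\<in>F. onorm (fun_scale (?c f) (\<Sum>b\<in>B. fun_scale (?d b) (\<Delta> f b))))"
      unfolding expand using sd by (intro onorm_sum_le dual_fun_scale)
    also have "\<dots> \<le> (\<Sum>f\<in>F. C' * onorm \<mu> * (card B * (C * bidual_norm smul \<Phi> * \<eta>)))"
    proof (rule sum_mono)
      fix f assume f: "f \<in> F"
      let ?s = "\<Sum>b\<in>B. fun_scale (?d b) (\<Delta> f b)"
      have "onorm (fun_scale (?c f) ?s) \<le> norm (?c f) * onorm ?s" by (rule onorm_fun_scale_le[OF sd[OF f]])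
      also have "\<dots> \<le> C' * onorm \<mu> * (card B * (C * bidual_norm smul \<Phi> * \<eta>))"
        using C'(1) onorm_dual_nonneg[OF \<mu>d] onorm_dual_nonneg[OF sd[OF f]]
        by (intro mult_mono C'(2)[OF \<mu> f] inner[OF f]) auto
      finally show "onorm (fun_scale (?c f) ?s) \<le> C' * onorm \<mu> * (card B * (C * bidual_norm smul \<Phi> * \<eta>))" .
    qed
    also have "\<dots> = K * \<eta> * onorm \<mu> * bidual_norm smul \<Phi>" by (simp add: K_def)
    finally show "onorm (dual_alg \<mu> (T \<Phi>) - dual_bidual \<mu> \<Phi>) \<le> K * \<eta> * onorm \<mu> * bidual_norm smul \<Phi>"
      by (simp add: \<Delta>_def)
  qed
qed

text \<open>Condition (2) speaks about all canonical elements of the space. A basis that extends a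
  basis of their subspace reduces it to prescribing \<open>T\<close> on basis elements.\<close>

lemma ex_basis_extending_canonical:
  assumes C: "finite C" and "C \<subseteq> bidual smul"
  shows "\<exists>B. finite B \<and> fs.independent B \<and> B \<subseteq> bidual smul \<and> fs.span B = fs.span C \<and>
    (\<forall>a. canonical_embedding smul a \<in> fs.span B \<longrightarrow>
       canonical_embedding smul a \<in> fs.span (B \<inter> range (canonical_embedding smul)))"
proof -
  define V where "V = fs.span C"
  have V: "fs.subspace V" "V \<subseteq> bidual smul"
    using fs.span_minimal[OF assms(2) subspace_bidual] by (simp_all add: V_def)
  let ?K = "V \<inter> range (canonical_embedding smul)"
  obtain B1 where B1: "B1 \<subseteq> ?K" "fs.independent B1" "?K \<subseteq> fs.span B1"
    using fs.maximal_independent_subset[of ?K] by blast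
  obtain B where B: "B1 \<subseteq> B" "B \<subseteq> V" "fs.independent B" "V \<subseteq> fs.span B"
    using fs.maximal_independent_subset_extend[of B1 V] B1 by blast
  show ?thesis
  proof (intro exI[of _ B] conjI allI impI)
    show "finite B" using fs.independent_span_bound[OF C B(3)] B(2) by (simp add: V_def)
    show "fs.independent B" by fact
    show "B \<subseteq> bidual smul" using B(2) V(2) by blast
    show span: "fs.span B = fs.span C"
      using B(4) fs.span_minimal[OF B(2) V(1)] by (simp add: V_def)
    fix a assume "canonical_embedding smul a \<in> fs.span B"
    then have "canonical_embedding smul a \<in> fs.span B1" using span B1(3) by (auto simp: V_def)
    moreover have "fs.span B1 \<subseteq> fs.span (B \<inter> range (canonical_embedding smul))"
      using B(1) B1(1) by (intro fs.span_mono) blast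
    ultimately show "canonical_embedding smul a \<in> fs.span (B \<inter> range (canonical_embedding smul))" by blast
  qed
qed

end

theorem theorem4p1:
  fixes smul :: "'k::real_or_complex \<Rightarrow> 'a::{real_normed_algebra, banach} \<Rightarrow> 'a"
    and M M\<^sub>0 :: "(('a \<Rightarrow> 'k) \<Rightarrow> 'k) set"
    and N N\<^sub>0 :: "('a \<Rightarrow> 'k) set"
    and \<epsilon> :: real
  assumes "banach_algebra_over smul"
    and "arens_regular smul"
    and "M \<subseteq> bidual smul" and "fin_dim_subspace fun_scale M"
    and "N \<subseteq> dual smul" and "fin_dim_subspace fun_scale N"
    and "\<epsilon> > 0"
    and "M\<^sub>0 = subspace_sum M (box_span smul M)"
    and "N\<^sub>0 = subspace_sum N (action_span M N)"
  shows "\<exists>T :: (('a \<Rightarrow> 'k) \<Rightarrow> 'k) \<Rightarrow> 'a.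
    linear_map_on fun_scale smul M\<^sub>0 T \<and>
    eps_isomorphism_on \<epsilon> M\<^sub>0 (bidual_norm smul) norm T \<and>
    (\<forall>\<Phi>\<in>M\<^sub>0. \<forall>\<mu>\<in>N\<^sub>0. \<Phi> \<mu> = \<mu> (T \<Phi>)) \<and>
    (\<forall>a. canonical_embedding smul a \<in> M\<^sub>0 \<longrightarrow> T (canonical_embedding smul a) = a) \<and>
    (\<forall>\<mu>\<in>N. \<forall>\<Phi>\<in>M. \<forall>\<Psi>\<in>M.
       norm (\<mu> (T (arens_box smul \<Phi> \<Psi>) - T \<Phi> * T \<Psi>))
         \<le> \<epsilon> * onorm \<mu> * bidual_norm smul \<Phi> * bidual_norm smul \<Psi>)"
proof -
  interpret banach_algebra_over smul by fact
  obtain BM where BM: "finite BM" "fs.independent BM" "M = fs.span BM"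
    using fin_dim_subspace_basis[OF assms(4)] by blast
  obtain BN where BN: "finite BN" "fs.independent BN" "N = fs.span BN"
    using fin_dim_subspace_basis[OF assms(6)] by blast
  have BN_dual: "BN \<subseteq> dual smul" using BN(3) assms(5) fs.span_superset by blast
  have BM_bidual: "BM \<subseteq> bidual smul" using BM(3) assms(3) fs.span_superset by blast
  define Q where "Q = (\<lambda>(b, b'). arens_box smul b b') ` (BM \<times> BM)"
  have Q: "arens_box smul \<Phi> \<Psi> \<in> fs.span Q" if "\<Phi> \<in> M" "\<Psi> \<in> M" for \<Phi> \<Psi>
    unfolding Q_def using that assms(3) unfolding BM(3)
    by (intro bilinear_span_image[OF vector_space_fun_scale vector_space_fun_scale vector_space_fun_scale BM(1,1)])
      (auto simp: linear_map_on_def arens_box_add_left arens_box_scale_left arens_box_add_right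
        arens_box_scale_right subset_eq)
  have box: "box_span smul M = fs.span Q"
    unfolding box_span_def
  proof (rule antisym)
    show "fs.span {arens_box smul \<Phi> \<Psi> |\<Phi> \<Psi>. \<Phi> \<in> M \<and> \<Psi> \<in> M} \<subseteq> fs.span Q"
      using Q by (intro fs.span_minimal fs.subspace_span) blast
    show "fs.span Q \<subseteq> fs.span {arens_box smul \<Phi> \<Psi> |\<Phi> \<Psi>. \<Phi> \<in> M \<and> \<Psi> \<in> M}"
    proof (intro fs.span_mono subsetI)
      fix q assume "q \<in> Q"
      then obtain b b' where "b \<in> BM" "b' \<in> BM" "q = arens_box smul b b'" by (auto simp: Q_def)
      moreover from this have "b \<in> M" "b' \<in> M" by (simp_all add: BM(3) fs.span_base)
      ultimately show "q \<in> {arens_box smul \<Phi> \<Psi> |\<Phi> \<Psi>. \<Phi> \<in> M \<and> \<Psi> \<in> M}" by blast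
    qed
  qed
  have M0: "M\<^sub>0 = fs.span (BM \<union> Q)"
    by (simp only: assms(8) subspace_sum_def box fs.span_Un BM(3)[symmetric])
  have "finite (BM \<union> Q)" "BM \<union> Q \<subseteq> bidual smul"
    using BM(1) BM_bidual by (auto simp: Q_def intro!: arens_box_bidual)
  from ex_basis_extending_canonical[OF this]
  obtain B where B: "finite B" "fs.independent B" "B \<subseteq> bidual smul" and spanB: "fs.span B = fs.span (BM \<union> Q)"
    and B\<kappa>: "\<forall>a. canonical_embedding smul a \<in> fs.span B \<longrightarrow>
       canonical_embedding smul a \<in> fs.span (B \<inter> range (canonical_embedding smul))"
    by (elim exE conjE)
  have M0B: "M\<^sub>0 = fs.span B" using M0 spanB by simp
  have M_sub: "M \<subseteq> fs.span B" unfolding spanB BM(3) by (intro fs.span_mono) blast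
  have B_bidual: "fs.span B \<subseteq> bidual smul" using fs.span_minimal[OF B(3) subspace_bidual] .
  obtain K where K: "0 \<le> K" and K_le: "\<forall>T \<eta>. linear_map_on fun_scale smul (fs.span B) T \<longrightarrow>
    (\<forall>f\<in>BN. \<forall>b\<in>B. onorm (dual_alg f (T b) - dual_bidual f b) \<le> \<eta>) \<longrightarrow>
    (\<forall>\<mu>\<in>fs.span BN. \<forall>\<Phi>\<in>fs.span B.
       onorm (dual_alg \<mu> (T \<Phi>) - dual_bidual \<mu> \<Phi>) \<le> K * \<eta> * onorm \<mu> * bidual_norm smul \<Phi>)"
    using ex_module_error_bound[OF B BN(1,2) BN_dual] by (elim exE conjE)
  obtain X Y \<eta>' where X: "finite X" "X \<subseteq> fs.span B" and Y: "finite Y" "Y \<subseteq> dual smul" and \<eta>': "0 < \<eta>'"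
    and iso: "\<forall>T. linear_map_on fun_scale smul (fs.span B) T \<longrightarrow> (\<forall>x\<in>X. norm (T x) \<le> bidual_norm smul x + \<eta>') \<longrightarrow>
      (\<forall>\<Phi>\<in>fs.span B. \<forall>\<mu>\<in>Y. \<Phi> \<mu> = \<mu> (T \<Phi>)) \<longrightarrow>
      eps_isomorphism_on \<epsilon> (fs.span B) (bidual_norm smul) norm T"
    using ex_eps_isomorphism_test[OF B \<open>\<epsilon> > 0\<close>] by (elim exE conjE)
  \<comment> \<open>The error in (3) is \<open>K * \<eta>\<close> from the module approximation
    times \<open>1 + \<epsilon>\<close> from the norm of \<open>T \<Psi>\<close>;
    \<open>K + 1\<close> avoids a zero denominator.\<close>
  define \<eta> where "\<eta> = min \<eta>' (\<epsilon> / ((K + 1) * (1 + \<epsilon>)))"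
  have \<eta>: "0 < \<eta>" "\<eta> \<le> \<eta>'" using \<eta>' K \<open>\<epsilon> > 0\<close> by (simp_all add: \<eta>_def)
  have \<eta>K: "K * \<eta> * (1 + \<epsilon>) \<le> \<epsilon>"
  proof -
    have "K * \<eta> * (1 + \<epsilon>) \<le> (K + 1) * (\<epsilon> / ((K + 1) * (1 + \<epsilon>))) * (1 + \<epsilon>)"
      using K \<eta>(1) \<open>\<epsilon> > 0\<close> by (intro mult_right_mono mult_mono) (auto simp: \<eta>_def)
    then show ?thesis using K \<open>\<epsilon> > 0\<close> by simp
  qed
  define R1 where "R1 = (\<lambda>(b, n). bidual_dual b n) ` (BM \<times> BN)"
  \<comment> \<open>These span the functionals \<open>\<mu> \<cdot> \<Phi>\<close> at which
    interpolation must be exact in the proof of (3), whereas \<open>R1\<close> accounts for the part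
    of \<open>N\<^sub>0\<close> beyond \<open>N\<close>.\<close>
  define R2 where "R2 = (\<lambda>(n, b). dual_bidual n b) ` (BN \<times> B)"
  have R1: "bidual_dual \<Phi> \<mu> \<in> fs.span R1" if "\<Phi> \<in> M" "\<mu> \<in> N" for \<Phi> \<mu>
    unfolding R1_def using that assms(3,5) unfolding BM(3) BN(3)
    by (intro bilinear_span_image[OF vector_space_fun_scale vector_space_fun_scale vector_space_fun_scale BM(1) BN(1)])
      (auto simp: linear_map_on_def bidual_dual_add_left bidual_dual_scale_left bidual_dual_add_right
        bidual_dual_scale_right subset_eq)
  have R2: "dual_bidual \<mu> \<Phi> \<in> fs.span R2" if "\<mu> \<in> N" "\<Phi> \<in> fs.span B" for \<Phi> \<mu>
    unfolding R2_def using that assms(5) B_bidual unfolding BN(3)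
    by (intro bilinear_span_image[OF vector_space_fun_scale vector_space_fun_scale vector_space_fun_scale BN(1) B(1)])
      (auto intro: linear_map_on_subset[OF dual_bidual_linear_left] dual_bidual_linear_right)
  \<comment> \<open>All requirements of exactness are collected: \<open>BN\<close> and
    \<open>R1\<close> for (1), \<open>R2\<close> for (3), and \<open>Y\<close> for the isomorphism
    estimate. Exactness on an independent subset that spans them suffices, by linearity.\<close>
  define H where "H = BN \<union> R1 \<union> R2 \<union> Y"
  have H: "finite H" "H \<subseteq> dual smul"
    using BN(1) BM(1) B(1) Y BN_dual BM_bidual B(3)
    by (auto simp: H_def R1_def R2_def intro!: bidual_dual_dual dual_bidual_dual)
  obtain F where F: "F \<subseteq> H" "fs.independent F" "H \<subseteq> fs.span F"
    using fs.maximal_independent_subset[of H] by blast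
  have F': "finite F" "F \<subseteq> dual smul" using F(1) H finite_subset by auto
  have HF: "fs.span S \<subseteq> fs.span F" if "S \<subseteq> H" for S
    using that F(3) by (intro fs.span_minimal fs.subspace_span) blast
  have N_sub: "N \<subseteq> fs.span F" unfolding BN(3) by (rule HF) (auto simp: H_def)
  have N0_sub: "N\<^sub>0 \<subseteq> fs.span F"
  proof -
    have "action_span M N \<subseteq> fs.span R1"
      unfolding action_span_def using R1 by (intro fs.span_minimal fs.subspace_span) blast
    also have "\<dots> \<subseteq> fs.span F" by (rule HF) (auto simp: H_def)
    finally show ?thesis
      unfolding assms(9) subspace_sum_def using N_sub fs.span_add by blast
  qed
  have R2F: "fs.span R2 \<subseteq> fs.span F" by (rule HF) (auto simp: H_def)
  have "finite (BN \<times> B)" "BN \<times> B \<subseteq> dual smul \<times> fs.span B"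
    using BN(1) B(1) BN_dual fs.span_superset by auto
  from ex_local_reflexivity_map[OF assms(2) B B\<kappa> F'(1) F(2) F'(2) X this \<eta>(1)]
  obtain T where T: "linear_map_on fun_scale smul (fs.span B) T"
    and T_eq: "\<forall>\<Phi>\<in>fs.span B. \<forall>\<mu>\<in>fs.span F. \<Phi> \<mu> = \<mu> (T \<Phi>)"
    and T_\<kappa>: "\<forall>a. canonical_embedding smul a \<in> fs.span B \<longrightarrow> T (canonical_embedding smul a) = a"
    and T_X: "\<forall>x\<in>X. norm (T x) < bidual_norm smul x + \<eta>"
    and T_P: "\<forall>(\<mu>, \<Phi>)\<in>BN \<times> B. onorm (dual_alg \<mu> (T \<Phi>) - dual_bidual \<mu> \<Phi>) < \<eta>"
    by (elim exE conjE)
  have T_iso: "eps_isomorphism_on \<epsilon> (fs.span B) (bidual_norm smul) norm T"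
  proof (rule iso[rule_format, OF T])
    show "norm (T x) \<le> bidual_norm smul x + \<eta>'" if "x \<in> X" for x
      using T_X that \<eta>(2) by force
    show "\<Phi> \<mu> = \<mu> (T \<Phi>)" if "\<Phi> \<in> fs.span B" "\<mu> \<in> Y" for \<Phi> \<mu>
      using that F(3) by (intro T_eq[rule_format]) (auto simp: H_def)
  qed
  have mult: "norm (\<mu> (T (arens_box smul \<Phi> \<Psi>) - T \<Phi> * T \<Psi>)) \<le> \<epsilon> * onorm \<mu> * bidual_norm smul \<Phi> * bidual_norm smul \<Psi>"
    if \<mu>: "\<mu> \<in> N" and \<Phi>: "\<Phi> \<in> M" and \<Psi>: "\<Psi> \<in> M" for \<mu> \<Phi> \<Psi>
  proof -
    have \<mu>d: "\<mu> \<in> dual smul" and \<Phi>b: "\<Phi> \<in> bidual smul" and \<Psi>b: "\<Psi> \<in> bidual smul"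
      using that assms(3,5) by auto
    have \<Phi>B: "\<Phi> \<in> fs.span B" and \<Psi>B: "\<Psi> \<in> fs.span B" using that M_sub by auto
    have "arens_box smul \<Phi> \<Psi> \<in> fs.span B"
      using Q[OF \<Phi> \<Psi>] fs.span_mono[of Q "BM \<union> Q"] unfolding spanB by blast
    then have "\<mu> (T (arens_box smul \<Phi> \<Psi>)) = arens_box smul \<Phi> \<Psi> \<mu>"
      using \<mu> N_sub by (intro T_eq[rule_format, symmetric]) auto
    also have "\<dots> = \<Psi> (dual_bidual \<mu> \<Phi>)"
      using assms(2) \<Phi>b \<Psi>b \<mu>d by (simp add: arens_regular_def arens_diamond_def)
    also have "\<dots> = dual_bidual \<mu> \<Phi> (T \<Psi>)"
      using R2[OF \<mu> \<Phi>B] R2F by (intro T_eq[rule_format, OF \<Psi>B]) blast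
    finally have "\<mu> (T (arens_box smul \<Phi> \<Psi>) - T \<Phi> * T \<Psi>) = - (dual_alg \<mu> (T \<Phi>) - dual_bidual \<mu> \<Phi>) (T \<Psi>)"
      by (simp add: dual_diff[OF \<mu>d] dual_alg_def)
    then have "norm (\<mu> (T (arens_box smul \<Phi> \<Psi>) - T \<Phi> * T \<Psi>)) =
        norm ((dual_alg \<mu> (T \<Phi>) - dual_bidual \<mu> \<Phi>) (T \<Psi>))" by (simp only: norm_minus_cancel)
    also have "\<dots> \<le> onorm (dual_alg \<mu> (T \<Phi>) - dual_bidual \<mu> \<Phi>) * norm (T \<Psi>)"
      by (intro dual_norm_le dual_minus dual_alg_dual dual_bidual_dual \<mu>d \<Phi>b)
    also have "\<dots> \<le> (K * \<eta> * onorm \<mu> * bidual_norm smul \<Phi>) * ((1 + \<epsilon>) * bidual_norm smul \<Psi>)"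
    proof (intro mult_mono)
      have "\<forall>f\<in>BN. \<forall>b\<in>B. onorm (dual_alg f (T b) - dual_bidual f b) \<le> \<eta>"
        using T_P by fastforce
      then show "onorm (dual_alg \<mu> (T \<Phi>) - dual_bidual \<mu> \<Phi>) \<le> K * \<eta> * onorm \<mu> * bidual_norm smul \<Phi>"
        using K_le T \<mu> \<Phi>B unfolding BN(3) by blast
      show "norm (T \<Psi>) \<le> (1 + \<epsilon>) * bidual_norm smul \<Psi>"
        using T_iso \<Psi>B unfolding eps_isomorphism_on_def by blast
    qed (use K \<eta>(1) onorm_dual_nonneg[OF \<mu>d] bidual_norm_nonneg[OF \<Phi>b] in simp_all)
    also have "\<dots> = (K * \<eta> * (1 + \<epsilon>)) * (onorm \<mu> * bidual_norm smul \<Phi> * bidual_norm smul \<Psi>)" by simp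
    also have "\<dots> \<le> \<epsilon> * (onorm \<mu> * bidual_norm smul \<Phi> * bidual_norm smul \<Psi>)"
      using onorm_dual_nonneg[OF \<mu>d] bidual_norm_nonneg \<Phi>b \<Psi>b by (intro mult_right_mono \<eta>K) simp
    finally show ?thesis by (simp add: mult.assoc)
  qed
  show ?thesis
    using T T_iso T_eq T_\<kappa> mult N0_sub unfolding M0B by (intro exI[of _ T]) blast
qed

end
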